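(* Let $\Omega \subset \mathbb{R}^N$ be an open bounded set with Lipschitz boundary. Suppose that $u \in BV(\Omega)$ is a function of least gradient in $\Omega$. Then $u \in L^\infty_{loc}(\Omega)$.
   Context: A function $u \in BV(\Omega)$ is of least gradient in $\Omega$ if for every $v \in BV(\Omega)$ compactly supported in $\Omega$ we have $\int_\Omega |Du| \leq \int_\Omega |D(u+v)|$, where $\int_\Omega |Du|$ denotes the (Euclidean) total variation of $u$ in $\Omega$. *)

theory Defs
  imports "HOL-Analysis.Analysis"
begin

text \<open>
  Elements of \<open>L\<^sup>1(\<Omega>)\<close>, \<open>BV(\<Omega>)\<close> and so on are represented by total functions of which only the
  values on \<open>\<Omega>\<close> matter; all notions below are invariant under changes on Lebesgue null sets.
\<close>

definition divergence :: "('a::euclidean_space \<Rightarrow> 'a) \<Rightarrow> 'a \<Rightarrow> real" where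
  "divergence \<phi> x = (\<Sum>b\<in>Basis. frechet_derivative \<phi> (at x) b \<bullet> b)"

text \<open>\<open>C\<^sub>c\<^sup>1(\<Omega>; \<real>\<^sup>N)\<close>, each field being extended by zero outside \<open>\<Omega>\<close>.\<close>

definition C1_compact_fields :: "'a::euclidean_space set \<Rightarrow> ('a \<Rightarrow> 'a) set" where
  "C1_compact_fields \<Omega> =
     {\<phi>. (\<exists>D :: 'a \<Rightarrow> 'a \<Rightarrow>\<^sub>L 'a. (\<forall>x. (\<phi> has_derivative blinfun_apply (D x)) (at x))
                              \<and> continuous_on UNIV D)
        \<and> compact (closure {x. \<phi> x \<noteq> 0}) \<and> closure {x. \<phi> x \<noteq> 0} \<subseteq> \<Omega>}"

definition total_variation :: "'a::euclidean_space set \<Rightarrow> ('a \<Rightarrow> real) \<Rightarrow> ereal" where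
  "total_variation \<Omega> u =
     (SUP \<phi> \<in> {\<phi> \<in> C1_compact_fields \<Omega>. \<forall>x. norm (\<phi> x) \<le> 1}.
        ereal (\<integral>x. u x * divergence \<phi> x \<partial>lebesgue_on \<Omega>))"

definition BV :: "'a::euclidean_space set \<Rightarrow> ('a \<Rightarrow> real) set" where
  "BV \<Omega> = {u. integrable (lebesgue_on \<Omega>) u \<and> total_variation \<Omega> u < \<infinity>}"

text \<open>Support in the sense of equivalence classes: \<open>v\<close> vanishes almost everywhere off a compact set.\<close>

definition compactly_supported_in :: "('a::euclidean_space \<Rightarrow> real) \<Rightarrow> 'a set \<Rightarrow> bool" where
  "compactly_supported_in v \<Omega> \<longleftrightarrow>
     (\<exists>K. compact K \<and> K \<subseteq> \<Omega> \<and> (AE x in lebesgue_on \<Omega>. x \<notin> K \<longrightarrow> v x = 0))"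

definition least_gradient :: "'a::euclidean_space set \<Rightarrow> ('a \<Rightarrow> real) \<Rightarrow> bool" where
  "least_gradient \<Omega> u \<longleftrightarrow> u \<in> BV \<Omega> \<and>
     (\<forall>v \<in> BV \<Omega>. compactly_supported_in v \<Omega> \<longrightarrow>
        total_variation \<Omega> u \<le> total_variation \<Omega> (\<lambda>x. u x + v x))"

text \<open>
  Near each boundary point, \<open>\<Omega>\<close> is the strict epigraph, in some direction \<open>e\<close>, of a Lipschitz
  function \<open>\<gamma>\<close> on the hyperplane orthogonal to \<open>e\<close>; the vector \<open>y - (y \<bullet> e) *\<^sub>R e\<close> is the orthogonal
  projection of \<open>y\<close> onto that hyperplane.
\<close>

definition lipschitz_boundary :: "'a::euclidean_space set \<Rightarrow> bool" where
  "lipschitz_boundary \<Omega> \<longleftrightarrow>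
     (\<forall>x \<in> frontier \<Omega>. \<exists>r>0. \<exists>e. norm e = 1 \<and>
        (\<exists>L (\<gamma> :: 'a \<Rightarrow> real). L-lipschitz_on {z. z \<bullet> e = 0} \<gamma> \<and>
           \<Omega> \<inter> ball x r = {y \<in> ball x r. \<gamma> (y - (y \<bullet> e) *\<^sub>R e) < y \<bullet> e}))"

definition Linf_loc :: "'a::euclidean_space set \<Rightarrow> ('a \<Rightarrow> real) set" where
  "Linf_loc \<Omega> = {u. u \<in> borel_measurable (lebesgue_on \<Omega>) \<and>
     (\<forall>K. compact K \<and> K \<subseteq> \<Omega> \<longrightarrow> (\<exists>C. AE x in lebesgue_on K. \<bar>u x\<bar> \<le> C))}"

end

theory Submission
  imports Defs
begin

text \<open>
  Put \<open>P = max 0 (u - k)\<close> and let \<open>\<eta>\<close> be a cut-off function. Comparing \<open>u\<close> with \<open>u - \<eta> P\<close> gives the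
  Caccioppoli inequality \<open>\<integral>|D(\<eta> P)| \<le> 2 \<integral> P |\<nabla>\<eta>|\<close>. Neither the coarea formula nor the measure \<open>|Du|\<close> is
  needed for this: for a \<open>C\<^sup>1\<close> approximation \<open>g(u)\<close> of \<open>P\<close>, test fields \<open>\<phi>\<close> for \<open>u - \<eta> g(u)\<close> and \<open>\<psi>\<close> for
  \<open>\<eta> g(u)\<close> combine, after mollification of \<open>u\<close>, into the single field
  \<open>(1 - \<eta> g'(u)) \<phi> + \<eta> g'(u) \<psi>\<close>, which has norm at most one and may be tested against \<open>u\<close>. Instead of
  the Sobolev inequality we use \<open>\<integral>w \<le> C |{w > 0}|\<^sup>1\<^sup>/\<^sup>N \<integral>|Dw|\<close> for \<open>w \<ge> 0\<close>, which follows from the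
  estimate \<open>\<integral>|w(x + h) - w(x)| dx \<le> |h| \<integral>|Dw|\<close> by averaging over \<open>h\<close> in a ball of twice the volume of
  \<open>{w > 0}\<close>. De Giorgi's iteration over shrinking balls and rising levels then bounds \<open>u\<close> from above, and
  from below by applying it to \<open>-u\<close>.
\<close>

section \<open>Convolution with a differentiable kernel\<close>

text \<open>The combined field comes from the product rule:
  \<open>D(u - \<eta> g(u)) = (1 - \<eta> g'(u)) Du - g(u) D\<eta>\<close> and
  \<open>D(\<eta> g(u)) = \<eta> g'(u) Du + g(u) D\<eta>\<close>. Since \<open>\<eta> g'(u)\<close>
  lies between 0 and 1, the two variations share a single copy of |Du|, and only 2 g(u) |D\<eta>| is
  left over; minimality then cancels the variation of u against that of the competitor. The obstacle
  is that g'(u) is no more regular than u, so the combined field is not a test field. With u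
  replaced by its mollification the field is continuous, and moving the mollification from u onto
  the field makes it C^1 without raising its norm. This is why g has to be C^1, why the
  mollification radius must stay below the distance of the supports to the boundary of \<Omega>, and
  why a kernel with Lipschitz derivative is enough. The iteration gains because the averaging radius
  may be taken proportional to the N-th root of the volume of {u > l}, and Chebyshev's inequality
  bounds that volume by the excess mass over a lower level k; the resulting estimate is superlinear
  in the excess.\<close>

lemma distr_lborel_reflect: "distr lborel borel (\<lambda>x. t - x) = (lborel :: 'a::euclidean_space measure)"
proof -
  have "(lborel :: 'a measure) = density (distr lborel borel (\<lambda>x. t + (-1) *\<^sub>R x)) (\<lambda>_. ennreal (\<bar>-1\<bar> ^ DIM('a)))"
    by (rule lborel_affine) simp
  then show ?thesis by (simp add: density_1)
qed

lemma integral_lborel_reflect: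
  fixes f :: "'a::euclidean_space \<Rightarrow> 'b::{banach, second_countable_topology}"
  assumes "f \<in> borel_measurable borel"
  shows "(\<integral>x. f (t - x) \<partial>lborel) = (\<integral>x. f x \<partial>lborel)"
proof -
  have "(\<integral>x. f x \<partial>distr lborel borel (\<lambda>x. t - x)) = (\<integral>x. f (t - x) \<partial>lborel)"
    by (rule integral_distr) (use assms in auto)
  then show ?thesis unfolding distr_lborel_reflect by simp
qed

lemma integrable_lborel_reflect:
  fixes f :: "'a::euclidean_space \<Rightarrow> 'b::{banach, second_countable_topology}"
  assumes "integrable lborel f"
  shows "integrable lborel (\<lambda>x. f (t - x))"
proof -
  have "f \<in> borel_measurable borel" using assms by auto
  then have "integrable (distr lborel borel (\<lambda>x. t - x)) f \<longleftrightarrow> integrable lborel (\<lambda>x. f (t - x))"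
    by (intro integrable_distr_eq) auto
  then show ?thesis using assms unfolding distr_lborel_reflect by simp
qed

lemma integral_lborel_translate:
  fixes f :: "'a::euclidean_space \<Rightarrow> 'b::{banach, second_countable_topology}"
  assumes "f \<in> borel_measurable borel"
  shows "(\<integral>x. f (x + t) \<partial>lborel) = (\<integral>x. f x \<partial>lborel)"
proof -
  have "(\<integral>x. f x \<partial>distr lborel borel ((+) t)) = (\<integral>x. f (t + x) \<partial>lborel)"
    by (rule integral_distr) (use assms in auto)
  then show ?thesis unfolding lborel_distr_plus by (simp add: add.commute)
qed

lemma integrable_lborel_translate:
  fixes f :: "'a::euclidean_space \<Rightarrow> 'b::{banach, second_countable_topology}"
  assumes "integrable lborel f"
  shows "integrable lborel (\<lambda>x. f (x + t))"
proof -
  have "f \<in> borel_measurable borel" using assms by auto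
  then have "integrable (distr lborel borel ((+) t)) f \<longleftrightarrow> integrable lborel (\<lambda>x. f (t + x))"
    by (intro integrable_distr_eq) auto
  then show ?thesis using assms unfolding lborel_distr_plus by (simp add: add.commute)
qed

text \<open>Continuity is required for each direction \<open>h\<close> separately. In finite
  dimension this is continuity of the operator-valued derivative, which
  \<open>C1_compact_fieldsI\<close> recovers componentwise. Naming \<open>f'\<close> explicitly
  keeps the product and chain rules computable.\<close>

definition C1_deriv :: "('a::euclidean_space \<Rightarrow> 'b::real_normed_vector) \<Rightarrow> ('a \<Rightarrow> 'a \<Rightarrow> 'b) \<Rightarrow> bool" where
  "C1_deriv f f' \<longleftrightarrow> (\<forall>x. (f has_derivative f' x) (at x)) \<and> (\<forall>h. continuous_on UNIV (\<lambda>x. f' x h))"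

text \<open>One constant serves as sup bound, as bound of the derivative and as its Lipschitz
  constant. The bounds make products with integrable functions integrable; the Lipschitz condition
  gives a quadratic Taylor remainder.\<close>

definition C11_deriv :: "('a::euclidean_space \<Rightarrow> 'b::real_normed_vector) \<Rightarrow> ('a \<Rightarrow> 'a \<Rightarrow> 'b) \<Rightarrow> real \<Rightarrow> bool" where
  "C11_deriv f f' L \<longleftrightarrow> (\<forall>x. (f has_derivative f' x) (at x)) \<and> (\<forall>x. norm (f x) \<le> L) \<and>
     (\<forall>x h. norm (f' x h) \<le> L * norm h) \<and> (\<forall>x y h. norm (f' x h - f' y h) \<le> L * norm (x - y) * norm h)"

lemma C1_deriv_has_derivative: "C1_deriv f f' \<Longrightarrow> (f has_derivative f' x) (at x)"
  by (simp add: C1_deriv_def)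

lemma C1_deriv_continuous: "C1_deriv f f' \<Longrightarrow> continuous_on UNIV f"
  by (meson C1_deriv_def continuous_at_imp_continuous_on has_derivative_continuous)

lemma C1_deriv_continuous_deriv: "C1_deriv f f' \<Longrightarrow> continuous_on UNIV (\<lambda>x. f' x h)"
  by (simp add: C1_deriv_def)

lemma C1_deriv_linear: "C1_deriv f f' \<Longrightarrow> bounded_linear (f' x)"
  using C1_deriv_has_derivative has_derivative_bounded_linear by blast

lemma C1_deriv_add:
  "C1_deriv f f' \<Longrightarrow> C1_deriv g g' \<Longrightarrow> C1_deriv (\<lambda>x. f x + g x) (\<lambda>x h. f' x h + g' x h)"
  by (auto simp: C1_deriv_def intro!: has_derivative_add continuous_intros)

lemma C1_deriv_diff:
  "C1_deriv f f' \<Longrightarrow> C1_deriv g g' \<Longrightarrow> C1_deriv (\<lambda>x. f x - g x) (\<lambda>x h. f' x h - g' x h)"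
  by (auto simp: C1_deriv_def intro!: has_derivative_diff continuous_intros)

lemma C1_deriv_scaleR:
  assumes "C1_deriv a a'" "C1_deriv F F'"
  shows "C1_deriv (\<lambda>x. a x *\<^sub>R F x) (\<lambda>x h. a x *\<^sub>R F' x h + a' x h *\<^sub>R F x)"
  using assms C1_deriv_continuous[OF assms(1)] C1_deriv_continuous[OF assms(2)]
  by (auto simp: C1_deriv_def intro!: has_derivative_scaleR continuous_intros)

lemma C1_deriv_compose_real:
  assumes f: "C1_deriv f f'" and g: "\<And>t. (g has_real_derivative g' t) (at t)" and g': "continuous_on UNIV g'"
  shows "C1_deriv (\<lambda>x. g (f x)) (\<lambda>x h. g' (f x) * f' x h)"
proof -
  have "((\<lambda>x. g (f x)) has_derivative (\<lambda>h. g' (f x) * f' x h)) (at x)" for x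
    using has_derivative_compose[OF C1_deriv_has_derivative[OF f] g[of "f x", unfolded has_field_derivative_def]]
    by simp
  moreover have "continuous_on UNIV (\<lambda>x. g' (f x))"
    using continuous_on_compose2[OF g' C1_deriv_continuous[OF f]] by simp
  ultimately show ?thesis
    using f by (auto simp: C1_deriv_def intro!: continuous_intros)
qed

lemma C11_imp_C1_deriv:
  assumes "C11_deriv f f' L"
  shows "C1_deriv f f'"
proof -
  have "continuous_on UNIV (\<lambda>x. f' x h)" for h
  proof -
    have L: "L * norm h \<ge> 0"
      using assms unfolding C11_deriv_def by (meson norm_ge_zero order_trans)
    have "(L * norm h)-lipschitz_on UNIV (\<lambda>x. f' x h)"
      by (rule lipschitz_onI)
        (use assms L in \<open>auto simp: C11_deriv_def dist_norm mult.assoc mult.commute[of "norm h"]\<close>)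
    then show ?thesis by (rule lipschitz_on_continuous_on)
  qed
  then show ?thesis using assms by (auto simp: C1_deriv_def C11_deriv_def)
qed

lemma C11_deriv_nonneg: "C11_deriv f f' L \<Longrightarrow> 0 \<le> L"
  unfolding C11_deriv_def by (meson norm_ge_zero order_trans)

text \<open>Along the segment from \<open>x\<close> to \<open>x + h\<close> the derivative deviates
  from \<open>f' x\<close> by at most \<open>L * norm h\<close>; the mean value inequality for the
  linearization does the rest.\<close>

lemma C11_taylor:
  assumes "C11_deriv f f' L"
  shows "norm (f (x + h) - f x - f' x h) \<le> L * norm h * norm h"
proof -
  have der: "(f has_derivative f' z) (at z)" for z using assms by (auto simp: C11_deriv_def)
  have L0: "0 \<le> L" using C11_deriv_nonneg[OF assms] .
  have "norm (f (x + h) - f x - f' x ((x + h) - x)) \<le> norm ((x + h) - x) * (L * norm h)"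
  proof (rule differentiable_bound_linearization[where S = "closed_segment x (x + h)"])
    show "x + t *\<^sub>R (x + h - x) \<in> closed_segment x (x + h)" if "t \<in> {0..1}" for t
      using that by (auto simp: closed_segment_def algebra_simps intro!: exI[of _ t])
    show "(f has_derivative f' z) (at z within closed_segment x (x + h))" for z
      using der has_derivative_at_withinI by blast
    show "onorm (f' z - f' x) \<le> L * norm h" if "z \<in> closed_segment x (x + h)" for z
    proof (rule onorm_le)
      fix v :: 'a
      have "norm (z - x) \<le> norm h"
        using segment_bound1[OF that] by (simp add: norm_minus_commute)
      then have "L * norm (z - x) * norm v \<le> L * norm h * norm v"
        by (intro mult_right_mono mult_left_mono L0) auto
      moreover have "norm (f' z v - f' x v) \<le> L * norm (z - x) * norm v"
        using assms by (auto simp: C11_deriv_def)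
      ultimately show "norm ((f' z - f' x) v) \<le> L * norm h * norm v" by simp
    qed
  qed auto
  then show ?thesis by (simp add: mult.commute mult.left_commute)
qed

text \<open>The kernel is scalar while \<open>f\<close> may be vector-valued, so that one operation
  mollifies both functions and fields.\<close>

definition conv :: "('a::euclidean_space \<Rightarrow> real) \<Rightarrow> ('a \<Rightarrow> 'b) \<Rightarrow> 'a \<Rightarrow> 'b::euclidean_space" where
  "conv k f x = (\<integral>y. k (x - y) *\<^sub>R f y \<partial>lborel)"

lemma integrable_bounded_scaleR:
  fixes f :: "'a \<Rightarrow> 'b::euclidean_space" and k :: "'a \<Rightarrow> real"
  assumes "integrable M f" "k \<in> borel_measurable M" "\<And>x. \<bar>k x\<bar> \<le> C"
  shows "integrable M (\<lambda>x. k x *\<^sub>R f x)"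
proof (rule Bochner_Integration.integrable_bound)
  show "integrable M (\<lambda>x. C * norm (f x))" using assms(1) by auto
  show "(\<lambda>x. k x *\<^sub>R f x) \<in> borel_measurable M"
    using assms by (intro borel_measurable_scaleR) auto
  show "AE x in M. norm (k x *\<^sub>R f x) \<le> norm (C * norm (f x))"
  proof (rule AE_I2)
    fix x
    have "\<bar>k x\<bar> * norm (f x) \<le> C * norm (f x)" using assms(3) by (intro mult_right_mono) auto
    also have "\<dots> \<le> \<bar>C * norm (f x)\<bar>" by simp
    finally show "norm (k x *\<^sub>R f x) \<le> norm (C * norm (f x))" by simp
  qed
qed

lemma norm_integral_scaleR_le:
  fixes f :: "'a \<Rightarrow> 'b::euclidean_space" and k :: "'a \<Rightarrow> real"
  assumes "integrable M f" "k \<in> borel_measurable M" "\<And>x. \<bar>k x\<bar> \<le> C"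
  shows "norm (\<integral>x. k x *\<^sub>R f x \<partial>M) \<le> C * (\<integral>x. norm (f x) \<partial>M)"
proof -
  have i: "integrable M (\<lambda>x. k x *\<^sub>R f x)" by (rule integrable_bounded_scaleR[OF assms])
  have "norm (\<integral>x. k x *\<^sub>R f x \<partial>M) \<le> (\<integral>x. norm (k x *\<^sub>R f x) \<partial>M)"
    by (rule integral_norm_bound)
  also have "\<dots> \<le> (\<integral>x. C * norm (f x) \<partial>M)"
    using integrable_norm[OF i] assms(1,3) by (intro integral_mono) (auto intro: mult_right_mono)
  finally show ?thesis by simp
qed

lemma borel_measurable_C1:
  fixes f :: "'a::euclidean_space \<Rightarrow> 'b::real_normed_vector"
  assumes "C1_deriv f f'"
  shows "f \<in> borel_measurable borel" "(\<lambda>x. f' x h) \<in> borel_measurable borel"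
  using C1_deriv_continuous[OF assms] C1_deriv_continuous_deriv[OF assms]
  by (auto intro: borel_measurable_continuous_onI)

text \<open>The Taylor estimate of the kernel is uniform in the base point. Integrated against
  \<open>f\<close> it leaves a remainder of at most \<open>L * norm h * norm h\<close> times the L^1
  norm of \<open>f\<close>, which is differentiability under the integral sign; the bounds of the
  kernel are inherited in the same way.\<close>

proposition C11_deriv_conv:
  fixes k :: "'a::euclidean_space \<Rightarrow> real" and f :: "'a \<Rightarrow> 'b::euclidean_space"
  assumes k: "C11_deriv k k' L" and f: "integrable lborel f"
  shows "C11_deriv (conv k f) (\<lambda>x h. \<integral>y. k' (x - y) h *\<^sub>R f y \<partial>lborel) (L * (\<integral>y. norm (f y) \<partial>lborel))"
proof -
  define D where "D = (\<lambda>x h. \<integral>y. k' (x - y) h *\<^sub>R f y \<partial>lborel)"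
  define I where "I = (\<integral>y. norm (f y) \<partial>lborel)"
  have I0: "0 \<le> I" unfolding I_def by simp
  have L0: "0 \<le> L" using C11_deriv_nonneg[OF k] .
  have [measurable]: "k \<in> borel_measurable borel" "(\<lambda>x. k' x h) \<in> borel_measurable borel" for h
    using borel_measurable_C1[OF C11_imp_C1_deriv[OF k]] by auto
  have m': "(\<lambda>y. k' (x - y) h) \<in> borel_measurable lborel" for x h
    using measurable_compose[of "\<lambda>y. x - y" lborel borel "\<lambda>z. k' z h" borel] by simp
  have lin: "linear (k' x)" for x
    using k by (auto simp: C11_deriv_def intro: has_derivative_linear)
  have kb: "\<bar>k x\<bar> \<le> L" and k'b: "\<bar>k' x h\<bar> \<le> L * norm h"
    and k'l: "\<bar>k' x h - k' y h\<bar> \<le> L * norm (x - y) * norm h" for x y h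
    using k by (auto simp: C11_deriv_def)
  have i0: "integrable lborel (\<lambda>y. k (x - y) *\<^sub>R f y)" for x
    by (rule integrable_bounded_scaleR[OF f, where C = L]) (auto intro: kb)
  have i1: "integrable lborel (\<lambda>y. k' (x - y) h *\<^sub>R f y)" for x h
    by (rule integrable_bounded_scaleR[OF f m', where C = "L * norm h"]) (auto intro: k'b)
  have b0: "norm (conv k f x) \<le> L * I" for x
    unfolding conv_def I_def by (rule norm_integral_scaleR_le[OF f]) (auto intro: kb)
  have b1: "norm (D x h) \<le> L * I * norm h" for x h
    using norm_integral_scaleR_le[OF f m', where C = "L * norm h"] k'b
    unfolding D_def I_def by (simp add: algebra_simps)
  have b2: "norm (D x h - D y h) \<le> L * I * norm (x - y) * norm h" for x y h
  proof -
    have "D x h - D y h = (\<integral>z. (k' (x - z) h - k' (y - z) h) *\<^sub>R f z \<partial>lborel)"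
      unfolding D_def using i1 by (simp add: scaleR_diff_left)
    also have "norm \<dots> \<le> (L * norm (x - y) * norm h) * I"
      unfolding I_def
      by (rule norm_integral_scaleR_le[OF f])
         (auto intro!: borel_measurable_diff m' order_trans[OF k'l])
    finally show ?thesis by (simp add: algebra_simps)
  qed
  have tay: "norm (conv k f (x + h) - conv k f x - D x h) \<le> L * norm h * norm h * I" for x h
  proof -
    have "conv k f (x + h) - conv k f x - D x h =
        (\<integral>y. (k (x + h - y) - k (x - y) - k' (x - y) h) *\<^sub>R f y \<partial>lborel)"
      unfolding D_def conv_def using i0 i1 by (simp add: scaleR_diff_left)
    also have "norm \<dots> \<le> (L * norm h * norm h) * I"
      unfolding I_def
    proof (rule norm_integral_scaleR_le[OF f])
      show "(\<lambda>y. k (x + h - y) - k (x - y) - k' (x - y) h) \<in> borel_measurable lborel"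
        by (intro borel_measurable_diff m') auto
      show "\<bar>k (x + h - y) - k (x - y) - k' (x - y) h\<bar> \<le> L * norm h * norm h" for y
        using C11_taylor[OF k, of "x - y" h] by (simp add: algebra_simps)
    qed
    finally show ?thesis .
  qed
  have "(conv k f has_derivative D x) (at x)" for x
    unfolding has_derivative_at_alt
  proof (intro conjI allI impI)
    show "bounded_linear (D x)"
    proof (rule bounded_linear_intro)
      show "D x (h + h') = D x h + D x h'" for h h'
        unfolding D_def using i1 by (simp add: linear_add[OF lin] scaleR_add_left)
      show "D x (c *\<^sub>R h) = c *\<^sub>R D x h" for c h
        unfolding D_def by (simp add: linear_scale[OF lin] flip: scaleR_scaleR)
      show "norm (D x h) \<le> norm h * (L * I)" for h
        using b1[of x h] by (simp add: mult.commute)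
    qed
    fix e :: real assume e: "0 < e"
    show "\<exists>d>0. \<forall>y. norm (y - x) < d \<longrightarrow> norm (conv k f y - conv k f x - D x (y - x)) \<le> e * norm (y - x)"
    proof (intro exI conjI allI impI)
      show "0 < e / (L * I + 1)" using e L0 I0 by (simp add: add_nonneg_pos)
      fix y assume y: "norm (y - x) < e / (L * I + 1)"
      have "L * I * norm (y - x) \<le> (L * I + 1) * norm (y - x)" by (simp add: algebra_simps)
      also have "\<dots> \<le> e"
        using y L0 I0 pos_less_divide_eq[of "L * I + 1" "norm (y - x)" e]
        by (simp add: add_nonneg_pos mult.commute)
      finally have "L * I * norm (y - x) * norm (y - x) \<le> e * norm (y - x)"
        by (rule mult_right_mono) simp
      then show "norm (conv k f y - conv k f x - D x (y - x)) \<le> e * norm (y - x)"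
        using tay[of x "y - x"] by (simp add: algebra_simps)
    qed
  qed
  then show ?thesis
    using b0 b1 b2 unfolding C11_deriv_def D_def I_def by blast
qed

section \<open>Divergence and compactly supported test fields\<close>

lemma divergence_eq:
  assumes "C1_deriv F F'"
  shows "divergence F x = (\<Sum>b\<in>Basis. F' x b \<bullet> b)"
  by (simp add: divergence_def flip: frechet_derivative_at[OF C1_deriv_has_derivative[OF assms]])

lemma continuous_divergence:
  assumes "C1_deriv F F'"
  shows "continuous_on UNIV (divergence F)"
proof -
  have "continuous_on UNIV (\<lambda>x. \<Sum>b\<in>Basis. F' x b \<bullet> b)"
    by (intro continuous_intros C1_deriv_continuous_deriv[OF assms])
  then show ?thesis by (simp add: divergence_eq[OF assms, abs_def])
qed

lemma C1_deriv_zero_outside: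
  assumes F: "C1_deriv F F'" and "closed K" and 0: "\<And>x. x \<notin> K \<Longrightarrow> F x = 0" and x: "x \<notin> K"
  shows "F' x h = 0"
proof -
  have "(F has_derivative (\<lambda>_. 0)) (at x)"
  proof (rule has_derivative_transform_within_open)
    show "((\<lambda>_. 0) has_derivative (\<lambda>_. 0)) (at x)" by simp
    show "open (- K)" using assms by auto
  qed (use x 0 in auto)
  then have "F' x = (\<lambda>_. 0)"
    using has_derivative_unique C1_deriv_has_derivative[OF F] by blast
  then show ?thesis by simp
qed

lemma divergence_zero_outside:
  assumes F: "C1_deriv F F'" and "closed K" and 0: "\<And>x. x \<notin> K \<Longrightarrow> F x = 0" and x: "x \<notin> K"
  shows "divergence F x = 0"
  by (simp add: divergence_eq[OF F] C1_deriv_zero_outside[OF assms])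

lemma C1_compact_fieldsI:
  assumes F: "C1_deriv F F'" and K: "compact K" "K \<subseteq> \<Omega>" and 0: "\<And>x. x \<notin> K \<Longrightarrow> F x = 0"
  shows "F \<in> C1_compact_fields \<Omega>"
proof -
  have cl: "closure {x. F x \<noteq> 0} \<subseteq> K"
    using 0 K(1) by (intro closure_minimal) (auto simp: compact_imp_closed)
  have app: "blinfun_apply (Blinfun (F' x)) = F' x" for x
    by (rule bounded_linear_Blinfun_apply[OF C1_deriv_linear[OF F]])
  have "continuous_on UNIV (\<lambda>x. Blinfun (F' x))"
    by (rule continuous_on_blinfun_componentwise) (simp add: app C1_deriv_continuous_deriv[OF F])
  then have "\<exists>D. (\<forall>x. (F has_derivative blinfun_apply (D x)) (at x)) \<and> continuous_on UNIV D"
    using C1_deriv_has_derivative[OF F] by (intro exI[of _ "\<lambda>x. Blinfun (F' x)"]) (simp add: app)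
  moreover have "compact (closure {x. F x \<noteq> 0})"
    using cl K(1) by (meson closed_closure compact_Int_closed compact_closure bounded_subset compact_imp_bounded closure_subset order_trans)
  ultimately show ?thesis using cl K(2) unfolding C1_compact_fields_def by blast
qed

lemma C1_compact_fieldsE:
  assumes "F \<in> C1_compact_fields \<Omega>"
  obtains F' K where "C1_deriv F F'" "compact K" "K \<subseteq> \<Omega>" "\<And>x. x \<notin> K \<Longrightarrow> F x = 0"
proof -
  obtain D where D: "\<And>x. (F has_derivative blinfun_apply (D x)) (at x)" "continuous_on UNIV D"
    and c: "compact (closure {x. F x \<noteq> 0})" "closure {x. F x \<noteq> 0} \<subseteq> \<Omega>"
    using assms unfolding C1_compact_fields_def by blast
  show thesis
  proof (rule that)
    show "C1_deriv F (\<lambda>x. blinfun_apply (D x))"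
      unfolding C1_deriv_def using D by (auto intro!: continuous_intros)
    show "F x = 0" if "x \<notin> closure {x. F x \<noteq> 0}" for x
      using that closure_subset[of "{x. F x \<noteq> 0}"] by auto
  qed (use c in auto)
qed

section \<open>The divergence theorem and continuity of translations\<close>

lemma integrable_continuous_compact_support:
  fixes f :: "'a::euclidean_space \<Rightarrow> 'b::euclidean_space"
  assumes "continuous_on UNIV f" "compact K" "\<And>x. x \<notin> K \<Longrightarrow> f x = 0"
  shows "integrable lborel f"
proof -
  have "integrable lborel (\<lambda>x. indicat_real K x *\<^sub>R f x)"
    using assms by (intro borel_integrable_compact continuous_on_subset[OF assms(1)]) auto
  moreover have "(\<lambda>x. indicat_real K x *\<^sub>R f x) = f"
    using assms(3) by (auto simp: indicator_def)
  ultimately show ?thesis by simp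
qed

lemma continuous_compact_support_bounded:
  fixes f :: "'a::euclidean_space \<Rightarrow> 'b::real_normed_vector"
  assumes "continuous_on UNIV f" "compact K" "\<And>x. x \<notin> K \<Longrightarrow> f x = 0"
  obtains C where "0 \<le> C" "\<And>x. norm (f x) \<le> C"
proof -
  have "bounded (f ` K)"
    by (meson assms(1,2) compact_continuous_image compact_imp_bounded continuous_on_subset subset_UNIV)
  then obtain C where "\<And>x. x \<in> K \<Longrightarrow> norm (f x) \<le> C" by (auto simp: bounded_iff)
  then have "norm (f x) \<le> max C 0" for x
    using assms(3)[of x] by (cases "x \<in> K") (auto simp: le_max_iff_disj)
  then show thesis by (intro that[of "max C 0"]) auto
qed

text \<open>Difference quotients of \<open>f\<close> in direction \<open>b\<close> integrate to zero
  by translation invariance, and they converge to \<open>f' x b\<close> with a common integrable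
  bound.\<close>

lemma integral_C1_deriv_zero:
  fixes f :: "'a::euclidean_space \<Rightarrow> real"
  assumes f: "C1_deriv f f'" and K: "compact K" and 0: "\<And>x. x \<notin> K \<Longrightarrow> f x = 0"
  shows "(\<integral>x. f' x b \<partial>lborel) = 0"
proof -
  have cK: "closed K" using K compact_imp_closed by blast
  have f'0: "f' x b = 0" if "x \<notin> K" for x
    by (rule C1_deriv_zero_outside[OF f cK 0 that])
  obtain C where C: "\<And>x. norm (f' x b) \<le> C"
    using continuous_compact_support_bounded[OF C1_deriv_continuous_deriv[OF f] K f'0] by blast
  obtain R where R: "\<And>x. x \<in> K \<Longrightarrow> norm x \<le> R"
    using K compact_imp_bounded bounded_iff by metis
  have intf: "integrable lborel f"
    by (rule integrable_continuous_compact_support[OF C1_deriv_continuous[OF f] K 0])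
  have mvt: "\<exists>z. 0 < z \<and> z < t \<and> f (x + t *\<^sub>R b) - f x = t * f' (x + z *\<^sub>R b) b" if "0 < t" for t x
  proof -
    have "((\<lambda>s. f (x + s *\<^sub>R b)) has_real_derivative f' (x + s *\<^sub>R b) b) (at s)" for s
    proof -
      have "((\<lambda>s. x + s *\<^sub>R b) has_derivative (\<lambda>s. s *\<^sub>R b)) (at s)"
        by (auto intro!: derivative_eq_intros)
      from has_derivative_compose[OF this C1_deriv_has_derivative[OF f]]
      have "((\<lambda>s. f (x + s *\<^sub>R b)) has_derivative (\<lambda>t. f' (x + s *\<^sub>R b) (t *\<^sub>R b))) (at s)" .
      moreover have "f' (x + s *\<^sub>R b) (t *\<^sub>R b) = f' (x + s *\<^sub>R b) b * t" for t
        using linear_scale[OF bounded_linear.linear[OF C1_deriv_linear[OF f]]] by simp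
      ultimately show ?thesis by (simp add: has_field_derivative_def)
    qed
    from MVT2[OF that this] show ?thesis by auto
  qed
  define \<tau> where "\<tau> n = 1 / real (Suc n)" for n
  have \<tau>: "0 < \<tau> n" "\<tau> n \<le> 1" for n by (auto simp: \<tau>_def)
  \<comment> \<open>The mean value theorem turns each quotient into a value of the derivative, which
    gives both the pointwise limit and the bound \<open>C\<close>.\<close>
  obtain Z where Z: "\<And>n x. 0 < Z n x" "\<And>n x. Z n x < \<tau> n"
    "\<And>n x. f (x + \<tau> n *\<^sub>R b) - f x = \<tau> n * f' (x + Z n x *\<^sub>R b) b"
    using mvt[OF \<tau>(1)] by metis
  define q where "q n x = (f (x + \<tau> n *\<^sub>R b) - f x) / \<tau> n" for n x
  have q: "q n x = f' (x + Z n x *\<^sub>R b) b" for n x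
    using \<tau>(1)[of n] Z(3)[of x n] by (simp add: q_def)
  have \<tau>0: "\<tau> \<longlonglongrightarrow> 0" unfolding \<tau>_def using LIMSEQ_inverse_real_of_nat by (simp add: inverse_eq_divide)
  have "(\<lambda>n. integral\<^sup>L lborel (q n)) \<longlonglongrightarrow> (\<integral>x. f' x b \<partial>lborel)"
  proof (rule integral_dominated_convergence)
    show "(\<lambda>x. f' x b) \<in> borel_measurable lborel" using borel_measurable_C1[OF f] by simp
    have [measurable]: "f \<in> borel_measurable borel" using borel_measurable_C1[OF f] by simp
    show "q n \<in> borel_measurable lborel" for n unfolding q_def by measurable
    \<comment> \<open>Steps have length at most 1, so a quotient at \<open>x\<close> looks at the
      derivative no further than \<open>norm b\<close> from \<open>x\<close>; hence the ball of
      radius \<open>R + norm b\<close>.\<close>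
    show "integrable lborel (\<lambda>x. C * indicat_real (cball 0 (R + norm b)) x)"
      using emeasure_lborel_cball_finite by (auto intro!: integrable_mult_right integrable_real_indicator)
    show "AE x in lborel. (\<lambda>n. q n x) \<longlonglongrightarrow> f' x b"
    proof (rule AE_I2)
      fix x
      have "(\<lambda>n. Z n x) \<longlonglongrightarrow> 0"
        by (rule tendsto_sandwich[OF _ _ tendsto_const \<tau>0]) (auto intro!: always_eventually less_imp_le Z)
      then have "(\<lambda>n. x + Z n x *\<^sub>R b) \<longlonglongrightarrow> x + 0 *\<^sub>R b" by (intro tendsto_intros)
      moreover have "isCont (\<lambda>x. f' x b) x"
        using C1_deriv_continuous_deriv[OF f] by (simp add: continuous_on_eq_continuous_at)
      ultimately show "(\<lambda>n. q n x) \<longlonglongrightarrow> f' x b"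
        unfolding q by (auto intro: isCont_tendsto_compose)
    qed
    show "AE x in lborel. norm (q n x) \<le> C * indicat_real (cball 0 (R + norm b)) x" for n
    proof (rule AE_I2)
      fix x
      show "norm (q n x) \<le> C * indicat_real (cball 0 (R + norm b)) x"
      proof (cases "x \<in> cball 0 (R + norm b)")
        case True
        then show ?thesis using C by (simp add: q)
      next
        case False
        then have n: "norm x > R + norm b" by simp
        have "norm (Z n x *\<^sub>R b) \<le> norm b"
          using Z(1)[of n x] Z(2)[of n x] \<tau>(2)[of n] by (simp add: mult_left_le_one_le)
        then have "norm (x + Z n x *\<^sub>R b) > R"
          using n norm_diff_ineq[of x "Z n x *\<^sub>R b"] by linarith
        then have "x + Z n x *\<^sub>R b \<notin> K" using R by force
        then show ?thesis using f'0 False by (simp add: q)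
      qed
    qed
  qed
  moreover have "integral\<^sup>L lborel (q n) = 0" for n
  proof -
    have "integral\<^sup>L lborel (q n) = ((\<integral>x. f (x + \<tau> n *\<^sub>R b) \<partial>lborel) - (\<integral>x. f x \<partial>lborel)) / \<tau> n"
      unfolding q_def using intf integrable_lborel_translate[OF intf] by simp
    also have "\<dots> = 0" using intf by (simp add: integral_lborel_translate)
    finally show ?thesis .
  qed
  ultimately show ?thesis by (simp add: LIMSEQ_const_iff)
qed

proposition integral_divergence_zero:
  assumes F: "C1_deriv F F'" and K: "compact K" and 0: "\<And>x. x \<notin> K \<Longrightarrow> F x = 0"
  shows "(\<integral>x. divergence F x \<partial>lborel) = 0"
proof -
  have cK: "closed K" using K compact_imp_closed by blast
  have i: "integrable lborel (\<lambda>x. F' x b \<bullet> b)" for b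
  proof (rule integrable_continuous_compact_support[OF _ K])
    show "continuous_on UNIV (\<lambda>x. F' x b \<bullet> b)"
      by (intro continuous_intros C1_deriv_continuous_deriv[OF F])
  qed (simp add: C1_deriv_zero_outside[OF F cK 0])
  have "C1_deriv (\<lambda>x. F x \<bullet> b) (\<lambda>x h. F' x h \<bullet> b)" for b
    using F by (auto simp: C1_deriv_def intro!: derivative_eq_intros continuous_intros)
  then have "(\<integral>x. F' x b \<bullet> b \<partial>lborel) = 0" for b
    by (rule integral_C1_deriv_zero[OF _ K]) (simp add: 0)
  then show ?thesis unfolding divergence_eq[OF F] using i by simp
qed

section \<open>Continuity of translations in L^1\<close>

definition L1_modulus :: "('a::euclidean_space \<Rightarrow> real) \<Rightarrow> 'a \<Rightarrow> real" where
  "L1_modulus f h = (\<integral>x. \<bar>f (x + h) - f x\<bar> \<partial>lborel)"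

lemma L1_modulus_add:
  assumes "integrable lborel f" "integrable lborel g"
  shows "L1_modulus (\<lambda>x. f x + g x) h \<le> L1_modulus f h + L1_modulus g h"
proof -
  note i = assms integrable_lborel_translate[OF assms(1)] integrable_lborel_translate[OF assms(2)]
  have "L1_modulus (\<lambda>x. f x + g x) h \<le> (\<integral>x. \<bar>f (x + h) - f x\<bar> + \<bar>g (x + h) - g x\<bar> \<partial>lborel)"
    unfolding L1_modulus_def using i by (intro integral_mono) auto
  also have "\<dots> = L1_modulus f h + L1_modulus g h"
    unfolding L1_modulus_def using i by (intro Bochner_Integration.integral_add) auto
  finally show ?thesis .
qed

lemma L1_modulus_le:
  assumes "integrable lborel f"
  shows "L1_modulus f h \<le> 2 * (\<integral>x. \<bar>f x\<bar> \<partial>lborel)"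
proof -
  note i = assms integrable_lborel_translate[OF assms]
  have "L1_modulus f h \<le> (\<integral>x. \<bar>f (x + h)\<bar> + \<bar>f x\<bar> \<partial>lborel)"
    unfolding L1_modulus_def using i by (intro integral_mono) auto
  also have "\<dots> = (\<integral>x. \<bar>f (x + h)\<bar> \<partial>lborel) + (\<integral>x. \<bar>f x\<bar> \<partial>lborel)"
    using i by (intro Bochner_Integration.integral_add) auto
  also have "(\<integral>x. \<bar>f (x + h)\<bar> \<partial>lborel) = (\<integral>x. \<bar>f x\<bar> \<partial>lborel)"
    using integral_lborel_translate[of "\<lambda>x. \<bar>f x\<bar>"] assms by auto
  finally show ?thesis by simp
qed

lemma L1_modulus_nonneg: "0 \<le> L1_modulus f h"
  unfolding L1_modulus_def by simp

text \<open>Translates of an open set cover it again in the limit, and they have the same volume, so it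
  suffices to estimate the part of the set that is lost.\<close>

lemma L1_modulus_open:
  fixes U :: "'a::euclidean_space set"
  assumes U: "open U" "emeasure lborel U < \<infinity>"
  shows "(L1_modulus (indicat_real U) \<longlongrightarrow> 0) (at 0)"
proof -
  have i: "integrable lborel (indicat_real U)" using U by (intro integrable_real_indicator) auto
  \<comment> \<open>Pointwise, \<open>\<bar>indicat_real U (x + h) - indicat_real U x\<bar>\<close>
    is the signed difference plus twice the lost part. The signed difference has integral zero,
    whence the factor 2.\<close>
  define J where "J h = (\<integral>x. 2 * (indicat_real U x * (1 - indicat_real U (x + h))) \<partial>lborel)" for h
  have "L1_modulus (indicat_real U) h = J h" for h
  proof -
    have p: "integrable lborel (\<lambda>x. indicat_real U x * indicat_real U (x + h))"
    proof (rule Bochner_Integration.integrable_bound[OF i])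
      have [measurable]: "U \<in> sets borel" using U by simp
      show "(\<lambda>x. indicat_real U x * indicat_real U (x + h)) \<in> borel_measurable lborel" by measurable
    qed (auto simp: indicator_def)
    have "L1_modulus (indicat_real U) h - J h = (\<integral>x. \<bar>indicat_real U (x + h) - indicat_real U x\<bar> -
        2 * (indicat_real U x * (1 - indicat_real U (x + h))) \<partial>lborel)"
      unfolding J_def L1_modulus_def
      using i integrable_lborel_translate[OF i] p
      by (intro Bochner_Integration.integral_diff[symmetric]) (auto simp: right_diff_distrib)
    also have "\<dots> = (\<integral>x. indicat_real U (x + h) - indicat_real U x \<partial>lborel)"
      by (intro Bochner_Integration.integral_cong) (auto simp: indicator_def)
    also have "\<dots> = 0"
      using i integrable_lborel_translate[OF i, of h] integral_lborel_translate[of "indicat_real U" h] U by simp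
    finally show ?thesis by simp
  qed
  moreover have "(J \<longlongrightarrow> 0) (at 0)"
    unfolding tendsto_at_iff_sequentially
  proof (intro allI impI)
    fix X :: "nat \<Rightarrow> 'a" assume X: "X \<longlonglongrightarrow> 0"
    have "(\<lambda>n. J (X n)) \<longlonglongrightarrow> (\<integral>x. 0 \<partial>(lborel :: 'a measure))"
      unfolding J_def
    proof (rule integral_dominated_convergence)
      have [measurable]: "U \<in> sets borel" using U by simp
      show "(\<lambda>x. 2 * (indicat_real U x * (1 - indicat_real U (x + X n)))) \<in> borel_measurable lborel" for n
        by measurable
      show "integrable lborel (\<lambda>x. 2 * indicat_real U x)" using i by simp
      show "AE x in lborel. norm (2 * (indicat_real U x * (1 - indicat_real U (x + X n)))) \<le> 2 * indicat_real U x" for n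
        by (auto simp: indicator_def)
      show "AE x in lborel. (\<lambda>n. 2 * (indicat_real U x * (1 - indicat_real U (x + X n)))) \<longlonglongrightarrow> 0"
      proof (rule AE_I2)
        fix x
        show "(\<lambda>n. 2 * (indicat_real U x * (1 - indicat_real U (x + X n)))) \<longlonglongrightarrow> 0"
        proof (cases "x \<in> U")
          case True
          have "(\<lambda>n. x + X n) \<longlonglongrightarrow> x + 0" using X by (intro tendsto_intros)
          then have "\<forall>\<^sub>F n in sequentially. x + X n \<in> U"
            using topological_tendstoD U(1) True by force
          then have "\<forall>\<^sub>F n in sequentially. 2 * (indicat_real U x * (1 - indicat_real U (x + X n))) = 0"
            by (rule eventually_mono) simp
          then show ?thesis by (rule tendsto_eventually)
        qed simp
      qed
    qed auto
    then show "(J \<circ> X) \<longlonglongrightarrow> 0" by (simp add: o_def)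
  qed
  ultimately show ?thesis by (simp add: ext[of "L1_modulus (indicat_real U)" J])
qed

text \<open>Approximation up to an arbitrary error by functions with limit zero; this lets the
  modulus of continuity pass from open sets to Borel sets and through L^1 limits.\<close>

lemma tendsto_0I_le:
  fixes f :: "'a \<Rightarrow> real"
  assumes "\<And>x. 0 \<le> f x" "\<And>e. 0 < e \<Longrightarrow> \<exists>g. (g \<longlongrightarrow> 0) F \<and> (\<forall>x. f x \<le> g x + e)"
  shows "(f \<longlongrightarrow> 0) F"
proof (rule tendstoI)
  fix e :: real assume "0 < e"
  then obtain g where g: "(g \<longlongrightarrow> 0) F" "\<And>x. f x \<le> g x + e / 2" using assms(2)[of "e / 2"] by auto
  have "\<forall>\<^sub>F x in F. dist (g x) 0 < e / 2" using g(1) \<open>0 < e\<close> by (intro tendstoD) auto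
  then show "\<forall>\<^sub>F x in F. dist (f x) 0 < e"
  proof (rule eventually_mono)
    fix x assume "dist (g x) 0 < e / 2"
    then show "dist (f x) 0 < e" using g(2)[of x] assms(1)[of x] by (simp add: dist_real_def)
  qed
qed

text \<open>Induction over integrable functions. A Borel set differs little in measure from an open
  superset; sums and limits follow from subadditivity and from the bound of the modulus by twice the
  L^1 norm.\<close>

proposition L1_modulus_tendsto_0:
  fixes f :: "'a::euclidean_space \<Rightarrow> real"
  assumes "integrable lborel f"
  shows "(L1_modulus f \<longlongrightarrow> 0) (at 0)"
  using assms
proof (induction rule: integrable_induct)
  case (base A c)
  then have Ab: "A \<in> sets borel" by simp
  have iA: "integrable lborel (indicat_real A)" using base by (intro integrable_real_indicator) auto
  have "(L1_modulus (indicat_real A) \<longlongrightarrow> 0) (at 0)"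
  proof (rule tendsto_0I_le[OF L1_modulus_nonneg])
    fix e :: real assume e: "0 < e"
    have "A \<in> sets lebesgue" using Ab by simp
    from sets_lebesgue_outer_open[OF this, of "e / 2"] e
    obtain U where U: "open U" "A \<subseteq> U" "U - A \<in> lmeasurable" "emeasure lebesgue (U - A) < ennreal (e / 2)" by auto
    have Ub: "U \<in> sets borel" using U by simp
    have d: "emeasure lborel (U - A) < ennreal (e / 2)" using U(4) Ab Ub by simp
    have "emeasure lborel U = emeasure lborel A + emeasure lborel (U - A)"
      using Ab Ub U(2) by (subst plus_emeasure) (auto simp: Un_absorb1)
    also have "\<dots> < \<infinity>" using base(2) d by (auto simp: less_top[symmetric])
    finally have Ufin: "emeasure lborel U < \<infinity>" .
    have iD: "integrable lborel (indicat_real (U - A))"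
      using d Ab Ub by (intro integrable_real_indicator) (auto simp: order_less_le_trans)
    have "measure lborel (U - A) \<le> e / 2"
      unfolding measure_def by (rule enn2real_leI) (use d e in auto)
    then have D: "(\<integral>x. \<bar>- indicat_real (U - A) x\<bar> \<partial>lborel) \<le> e / 2" using Ab Ub by simp
    have "L1_modulus (indicat_real A) h \<le> L1_modulus (indicat_real U) h + e" for h
    proof -
      have "indicat_real A = (\<lambda>x. indicat_real U x + (- indicat_real (U - A) x))"
        using U(2) by (auto simp: fun_eq_iff indicator_def)
      then have "L1_modulus (indicat_real A) h \<le> L1_modulus (indicat_real U) h + L1_modulus (\<lambda>x. - indicat_real (U - A) x) h"
        using L1_modulus_add[of "indicat_real U" "\<lambda>x. - indicat_real (U - A) x" h] iD Ufin Ub by simp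
      also have "L1_modulus (\<lambda>x. - indicat_real (U - A) x) h \<le> e"
        using L1_modulus_le[of "\<lambda>x. - indicat_real (U - A) x" h] iD D by simp
      finally show ?thesis by simp
    qed
    then show "\<exists>g. (g \<longlongrightarrow> 0) (at 0) \<and> (\<forall>h. L1_modulus (indicat_real A) h \<le> g h + e)"
      using L1_modulus_open[OF U(1) Ufin] by blast
  qed
  then have "((\<lambda>h. \<bar>c\<bar> * L1_modulus (indicat_real A) h) \<longlongrightarrow> \<bar>c\<bar> * 0) (at 0)"
    by (intro tendsto_intros)
  moreover have "L1_modulus (\<lambda>x. indicat_real A x *\<^sub>R c) = (\<lambda>h. \<bar>c\<bar> * L1_modulus (indicat_real A) h)"
  proof (rule ext)
    fix h
    have "L1_modulus (\<lambda>x. indicat_real A x *\<^sub>R c) h =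
        (\<integral>x. \<bar>c\<bar> * \<bar>indicat_real A (x + h) - indicat_real A x\<bar> \<partial>lborel)"
      unfolding L1_modulus_def real_scaleR_def
      by (rule arg_cong[of _ _ "integral\<^sup>L lborel"])
         (simp add: fun_eq_iff right_diff_distrib mult.commute flip: abs_mult)
    then show "L1_modulus (\<lambda>x. indicat_real A x *\<^sub>R c) h = \<bar>c\<bar> * L1_modulus (indicat_real A) h"
      by (simp add: L1_modulus_def)
  qed
  ultimately show ?case by simp
next
  case (add f g)
  have "((\<lambda>h. L1_modulus f h + L1_modulus g h) \<longlongrightarrow> 0) (at 0)"
    using tendsto_add[OF add(3,4)] by simp
  then show ?case
    using L1_modulus_add[OF add(1,2)] by (intro tendsto_0I_le[OF L1_modulus_nonneg]) (force simp: add_increasing2)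
next
  case (lim f s)
  show ?case
  proof (rule tendsto_0I_le[OF L1_modulus_nonneg])
    fix e :: real assume e: "0 < e"
    have "(\<lambda>i. \<integral>x. \<bar>f x - s i x\<bar> \<partial>lborel) \<longlonglongrightarrow> (\<integral>x. 0 \<partial>(lborel :: 'a measure))"
    proof (rule integral_dominated_convergence)
      show "(\<lambda>x. \<bar>f x - s i x\<bar>) \<in> borel_measurable lborel" for i
        using lim(1)[of i] lim(4) by auto
      \<comment> \<open>The induction rule provides approximations with
        \<open>\<bar>s i x\<bar> \<le> 2 * \<bar>f x\<bar>\<close>; adding
        \<open>\<bar>f x\<bar>\<close> gives 3.\<close>
      show "integrable lborel (\<lambda>x. 3 * \<bar>f x\<bar>)" using lim(4) by auto
      show "AE x in lborel. (\<lambda>i. \<bar>f x - s i x\<bar>) \<longlonglongrightarrow> 0"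
      proof (rule AE_I2)
        fix x
        have "(\<lambda>i. \<bar>f x - s i x\<bar>) \<longlonglongrightarrow> \<bar>f x - f x\<bar>"
          using lim(2)[of x] by (intro tendsto_intros) simp
        then show "(\<lambda>i. \<bar>f x - s i x\<bar>) \<longlonglongrightarrow> 0" by simp
      qed
      show "AE x in lborel. norm \<bar>f x - s i x\<bar> \<le> 3 * \<bar>f x\<bar>" for i
      proof (rule AE_I2)
        fix x
        show "norm \<bar>f x - s i x\<bar> \<le> 3 * \<bar>f x\<bar>" using lim(3)[of x i] by simp
      qed
    qed auto
    then have "\<forall>\<^sub>F i in sequentially. (\<integral>x. \<bar>f x - s i x\<bar> \<partial>lborel) < e / 2"
      using e by (intro order_tendstoD) auto
    then obtain i where i: "(\<integral>x. \<bar>f x - s i x\<bar> \<partial>lborel) < e / 2"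
      by (auto simp: eventually_sequentially)
    have "L1_modulus f h \<le> L1_modulus (s i) h + e" for h
      using L1_modulus_add[of "s i" "\<lambda>x. f x - s i x" h] L1_modulus_le[of "\<lambda>x. f x - s i x" h] i lim(1,4)
      by auto
    then show "\<exists>g. (g \<longlongrightarrow> 0) (at 0) \<and> (\<forall>h. L1_modulus f h \<le> g h + e)"
      using lim(5) by blast
  qed
qed

section \<open>Mollification\<close>

text \<open>A polynomial bump supported in the ball of radius \<open>e\<close>. Squaring the
  positive part removes the kink on the sphere and gives a Lipschitz derivative, which is all the
  smoothness used below.\<close>

definition bump :: "real \<Rightarrow> 'a::euclidean_space \<Rightarrow> real" where
  "bump e x = (max 0 (e\<^sup>2 - x \<bullet> x))\<^sup>2"

definition bump_deriv :: "real \<Rightarrow> 'a::euclidean_space \<Rightarrow> 'a \<Rightarrow> real" where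
  "bump_deriv e x h = - 4 * max 0 (e\<^sup>2 - x \<bullet> x) * (x \<bullet> h)"

text \<open>Whatever the signs of \<open>s\<close> and \<open>t\<close>, the first-order remainder
  is at most \<open>(s - t)\<^sup>2\<close>.\<close>

lemma has_real_derivative_max_0_square:
  "((\<lambda>t::real. (max 0 t)\<^sup>2) has_real_derivative 2 * max 0 t) (at t)"
proof -
  have b: "\<bar>(max 0 s)\<^sup>2 - (max 0 t)\<^sup>2 - 2 * max 0 t * (s - t)\<bar> \<le> (s - t)\<^sup>2" for s :: real
  proof -
    consider "0 \<le> t" "0 \<le> s" | "0 \<le> t" "s < 0" | "t < 0" "0 \<le> s" | "t < 0" "s < 0" by linarith
    then show ?thesis
    proof cases
      case 1
      then have "(max 0 s)\<^sup>2 - (max 0 t)\<^sup>2 - 2 * max 0 t * (s - t) = (s - t)\<^sup>2"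
        by (simp add: power2_eq_square algebra_simps)
      then show ?thesis by simp
    next
      case 2
      then have "(max 0 s)\<^sup>2 - (max 0 t)\<^sup>2 - 2 * max 0 t * (s - t) = (s - t)\<^sup>2 - s\<^sup>2"
        by (simp add: power2_eq_square algebra_simps)
      moreover have "s\<^sup>2 \<le> (s - t)\<^sup>2" using 2 by (intro abs_le_square_iff[THEN iffD1]) auto
      ultimately show ?thesis by simp
    next
      case 3
      then have "s\<^sup>2 \<le> (s - t)\<^sup>2" by (intro abs_le_square_iff[THEN iffD1]) auto
      then show ?thesis using 3 by simp
    qed auto
  qed
  have "((\<lambda>t::real. (max 0 t)\<^sup>2) has_derivative (*) (2 * max 0 t)) (at t)"
    unfolding has_derivative_at_alt
  proof (intro conjI allI impI exI)
    fix e :: real assume e: "0 < e"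
    show "0 < e" by fact
    fix s assume s: "norm (s - t) < e"
    have "(s - t)\<^sup>2 \<le> e * \<bar>s - t\<bar>"
      using mult_right_mono[of "\<bar>s - t\<bar>" e "\<bar>s - t\<bar>"] s by (simp add: power2_eq_square)
    then show "norm ((max 0 s)\<^sup>2 - (max 0 t)\<^sup>2 - 2 * max 0 t * (s - t)) \<le> e * norm (s - t)"
      using b[of s] by simp
  qed (rule bounded_linear_mult_right)
  then show ?thesis by (simp add: has_field_derivative_def)
qed

lemma bump_has_derivative: "(bump e has_derivative bump_deriv e x) (at x)"
proof -
  have "((\<lambda>x. e\<^sup>2 - x \<bullet> x) has_derivative (\<lambda>h. - 2 * (x \<bullet> h))) (at x)"
    by (auto intro!: derivative_eq_intros simp: inner_commute)
  from has_derivative_compose[OF this has_real_derivative_max_0_square[unfolded has_field_derivative_def]]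
  show ?thesis by (simp add: bump_def[abs_def] bump_deriv_def[abs_def] mult.assoc)
qed

lemma bump_nonneg: "0 \<le> bump e x" by (simp add: bump_def)

lemma dot_square_less_iff: "0 \<le> e \<Longrightarrow> x \<bullet> x < e\<^sup>2 \<longleftrightarrow> norm x < e" for e :: real
  by (metis abs_norm_cancel abs_of_nonneg abs_square_less_1 dot_square_norm norm_ge_zero power2_less_imp_less power_strict_mono zero_less_numeral)

lemma bump_zero: "0 \<le> e \<Longrightarrow> e \<le> norm x \<Longrightarrow> bump e x = 0" "0 \<le> e \<Longrightarrow> e \<le> norm x \<Longrightarrow> bump_deriv e x h = 0"
  using dot_square_less_iff[of e x] by (auto simp: bump_def bump_deriv_def)

lemma bump_deriv_le:
  assumes "0 \<le> e"
  shows "\<bar>bump_deriv e x h\<bar> \<le> 4 * e ^ 3 * norm h"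
proof (cases "norm x < e")
  case True
  have "\<bar>x \<bullet> h\<bar> \<le> e * norm h"
    using Cauchy_Schwarz_ineq2[of x h] True mult_right_mono[of "norm x" e "norm h"] by auto
  moreover have "\<bar>max 0 (e\<^sup>2 - x \<bullet> x)\<bar> \<le> e\<^sup>2" by simp
  ultimately have "\<bar>max 0 (e\<^sup>2 - x \<bullet> x)\<bar> * \<bar>x \<bullet> h\<bar> \<le> e\<^sup>2 * (e * norm h)"
    by (intro mult_mono) auto
  then show ?thesis by (simp add: bump_deriv_def abs_mult power2_eq_square power3_eq_cube mult.assoc)
next
  case False
  then show ?thesis using bump_zero(2)[OF assms, of x h] assms by simp
qed

lemma bump_le: "bump e x \<le> e ^ 4"
proof -
  have "(max 0 (e\<^sup>2 - x \<bullet> x))\<^sup>2 \<le> (e\<^sup>2)\<^sup>2" by (intro power_mono) auto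
  then show ?thesis by (simp add: bump_def flip: power_mult)
qed

text \<open>Up to the factor -4, \<open>m x *\<^sub>R x\<close> is the gradient of the bump. It
  vanishes off the ball, so one point may be assumed inside. The constant 3 adds 1 for the bound
  \<open>e\<^sup>2\<close> of \<open>m\<close> and 2 for its variation, at rate
  \<open>2 * e\<close>, times \<open>norm y \<le> e\<close>.\<close>

lemma bump_field_lipschitz:
  fixes x y :: "'a::euclidean_space"
  assumes e: "0 \<le> e"
  defines "m \<equiv> \<lambda>x::'a. max 0 (e\<^sup>2 - x \<bullet> x)"
  shows "norm (m x *\<^sub>R x - m y *\<^sub>R y) \<le> 3 * e\<^sup>2 * norm (x - y)"
proof -
  have m0: "m z = 0" if "e \<le> norm z" for z :: 'a
    using dot_square_less_iff[of e z] that e by (auto simp: m_def)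
  have mb: "\<bar>m z\<bar> \<le> e\<^sup>2" for z by (simp add: m_def)
  have *: "norm (m x *\<^sub>R x - m y *\<^sub>R y) \<le> 3 * e\<^sup>2 * norm (x - y)" if y: "norm y \<le> e" for x y :: 'a
  proof -
    have d: "\<bar>m x - m y\<bar> \<le> 2 * e * norm (x - y)"
    proof (cases "norm x \<le> e")
      case True
      have "\<bar>m x - m y\<bar> \<le> \<bar>x \<bullet> x - y \<bullet> y\<bar>" by (simp add: m_def)
      also have "x \<bullet> x - y \<bullet> y = (x - y) \<bullet> (x + y)" 
          by (simp add: inner_diff_left inner_add_right inner_commute[of y x])
      also have "\<bar>\<dots>\<bar> \<le> norm (x - y) * norm (x + y)" by (rule Cauchy_Schwarz_ineq2)
      also have "\<dots> \<le> norm (x - y) * (2 * e)"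
        using True y norm_triangle_ineq[of x y] by (intro mult_left_mono) auto
      finally show ?thesis by (simp add: mult.commute mult.left_commute)
    next
      case False
      \<comment> \<open>Here \<open>x\<close> lies outside the ball, so \<open>m x\<close> is zero
        and \<open>e - norm y\<close> is at most \<open>norm (x - y)\<close>.\<close>
      have "m y = e\<^sup>2 - (norm y)\<^sup>2" using y e by (simp add: m_def dot_square_norm power_mono)
      also have "\<dots> = (e - norm y) * (e + norm y)" by (simp add: power2_eq_square algebra_simps)
      also have "\<dots> \<le> norm (x - y) * (2 * e)"
        using False y e norm_triangle_ineq2[of x y] by (intro mult_mono) auto
      finally show ?thesis using m0[of x] False by (simp add: m_def mult.commute mult.left_commute)
    qed
    have xe: "\<bar>m x\<bar> * norm (x - y) \<le> e\<^sup>2 * norm (x - y)" using mb by (intro mult_right_mono) auto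
    have "m x *\<^sub>R x - m y *\<^sub>R y = m x *\<^sub>R (x - y) + (m x - m y) *\<^sub>R y" by (simp add: algebra_simps)
    also have "norm \<dots> \<le> \<bar>m x\<bar> * norm (x - y) + \<bar>m x - m y\<bar> * norm y"
      by (metis norm_scaleR norm_triangle_ineq)
    also have "\<dots> \<le> e\<^sup>2 * norm (x - y) + (2 * e * norm (x - y)) * e"
      using d y e by (intro add_mono[OF xe] mult_mono) auto
    finally show ?thesis by (simp add: power2_eq_square)
  qed
  consider "norm y \<le> e" | "norm x \<le> e" | "e < norm x" "e < norm y" by linarith
  then show ?thesis
  proof cases
    case 2
    then show ?thesis using *[of x y] by (simp add: norm_minus_commute)
  next
    case 3
    then show ?thesis using m0[of x] m0[of y] e by simp
  qed (rule *)
qed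

text \<open>The constant is the sum of the separate bounds: \<open>e ^ 4\<close> for the values,
  \<open>4 * e ^ 3\<close> for the derivative and \<open>4 * (3 * e\<^sup>2)\<close> for its
  Lipschitz constant.\<close>

lemma C11_bump:
  assumes "0 \<le> e"
  shows "C11_deriv (bump e :: 'a::euclidean_space \<Rightarrow> real) (bump_deriv e) (e ^ 4 + 4 * e ^ 3 + 12 * e\<^sup>2)"
  unfolding C11_deriv_def
proof (intro conjI allI)
  fix x y h :: 'a
  show "(bump e has_derivative bump_deriv e x) (at x)" by (rule bump_has_derivative)
  show "norm (bump e x) \<le> e ^ 4 + 4 * e ^ 3 + 12 * e\<^sup>2"
    using bump_le[of e x] bump_nonneg[of e x] assms by (simp add: add_increasing2)
  have "norm (bump_deriv e x h) \<le> (4 * e ^ 3) * norm h" using bump_deriv_le[OF assms] by simp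
  also have "\<dots> \<le> (e ^ 4 + 4 * e ^ 3 + 12 * e\<^sup>2) * norm h"
    using assms by (intro mult_right_mono) auto
  finally show "norm (bump_deriv e x h) \<le> (e ^ 4 + 4 * e ^ 3 + 12 * e\<^sup>2) * norm h" .
  define z where "z = max 0 (e\<^sup>2 - x \<bullet> x) *\<^sub>R x - max 0 (e\<^sup>2 - y \<bullet> y) *\<^sub>R y"
  have "bump_deriv e x h - bump_deriv e y h = - 4 * (z \<bullet> h)"
    by (simp add: bump_deriv_def z_def inner_diff_left)
  then have "norm (bump_deriv e x h - bump_deriv e y h) \<le> 4 * (norm z * norm h)"
    using Cauchy_Schwarz_ineq2[of z h] by (simp add: abs_mult)
  also have "\<dots> \<le> 4 * ((3 * e\<^sup>2 * norm (x - y)) * norm h)"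
    using bump_field_lipschitz[OF assms, of x y] unfolding z_def
    by (intro mult_left_mono mult_right_mono) auto
  also have "\<dots> = (12 * e\<^sup>2) * (norm (x - y) * norm h)" by simp
  also have "\<dots> \<le> (e ^ 4 + 4 * e ^ 3 + 12 * e\<^sup>2) * (norm (x - y) * norm h)"
    using assms by (intro mult_right_mono) auto
  finally show "norm (bump_deriv e x h - bump_deriv e y h) \<le> (e ^ 4 + 4 * e ^ 3 + 12 * e\<^sup>2) * norm (x - y) * norm h"
    by (simp add: mult.assoc)
qed

lemma integrable_bump: "0 \<le> e \<Longrightarrow> integrable lborel (bump e :: 'a::euclidean_space \<Rightarrow> real)"
  by (rule integrable_continuous_compact_support[of _ "cball 0 e"])
     (auto simp: bump_zero intro: C1_deriv_continuous C11_imp_C1_deriv C11_bump)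

lemma integral_bump_pos:
  assumes e: "0 < e"
  shows "0 < (\<integral>x. bump e (x::'a::euclidean_space) \<partial>lborel)"
proof -
  \<comment> \<open>On the ball of radius \<open>e / 2\<close> the inner expression of the bump is
    at least \<open>e\<^sup>2 - (e / 2)\<^sup>2\<close>, which is
    \<open>e\<^sup>2 * (3 / 4)\<close>.\<close>
  have "0 < (e\<^sup>2 * (3 / 4))\<^sup>2 * measure lborel (ball (0::'a) (e / 2))"
    using e content_ball_pos[of "e / 2" "0 :: 'a"] by simp
  also have "\<dots> = (\<integral>x. (e\<^sup>2 * (3 / 4))\<^sup>2 * indicat_real (ball 0 (e / 2)) (x::'a) \<partial>lborel)" by simp
  also have "\<dots> \<le> (\<integral>x. bump e (x::'a) \<partial>lborel)"
  proof (rule integral_mono)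
    show "integrable lborel (\<lambda>x::'a. (e\<^sup>2 * (3 / 4))\<^sup>2 * indicat_real (ball 0 (e / 2)) x)"
      using emeasure_lborel_ball_finite by (auto intro!: integrable_mult_right integrable_real_indicator)
    show "integrable lborel (bump e :: 'a \<Rightarrow> real)" using e by (intro integrable_bump) auto
    fix x :: 'a
    show "(e\<^sup>2 * (3 / 4))\<^sup>2 * indicat_real (ball 0 (e / 2)) x \<le> bump e x"
    proof (cases "norm x < e / 2")
      case True
      then have "x \<bullet> x \<le> (e / 2)\<^sup>2" by (simp add: dot_square_norm power_mono)
      then have "e\<^sup>2 * (3 / 4) \<le> max 0 (e\<^sup>2 - x \<bullet> x)" by (simp add: power_divide le_max_iff_disj)
      then have "(e\<^sup>2 * (3 / 4))\<^sup>2 \<le> bump e x" unfolding bump_def by (intro power_mono) auto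
      then show ?thesis using True by simp
    qed (simp add: bump_nonneg)
  qed
  finally show ?thesis .
qed

definition mollifier :: "real \<Rightarrow> 'a::euclidean_space \<Rightarrow> real" where
  "mollifier e x = bump e x / (\<integral>y. bump e (y::'a) \<partial>lborel)"

definition mollifier_deriv :: "real \<Rightarrow> 'a::euclidean_space \<Rightarrow> 'a \<Rightarrow> real" where
  "mollifier_deriv e x h = bump_deriv e x h / (\<integral>y. bump e (y::'a) \<partial>lborel)"

lemma C11_deriv_scale:
  assumes "C11_deriv f f' L"
  shows "C11_deriv (\<lambda>x. f x / c) (\<lambda>x h. f' x h / c :: real) (L / \<bar>c\<bar>)"
proof (cases "c = 0")
  case False
  have "\<bar>f' x h / c - f' y h / c\<bar> \<le> L / \<bar>c\<bar> * norm (x - y) * norm h" for x y h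
  proof -
    have "\<bar>f' x h / c - f' y h / c\<bar> = \<bar>f' x h - f' y h\<bar> / \<bar>c\<bar>"
      by (simp add: abs_divide flip: diff_divide_distrib)
    also have "\<dots> \<le> (L * norm (x - y) * norm h) / \<bar>c\<bar>"
      using assms by (intro divide_right_mono) (auto simp: C11_deriv_def)
    finally show ?thesis by simp
  qed
  then show ?thesis
    using assms False
    by (auto simp: C11_deriv_def divide_right_mono abs_divide intro!: derivative_eq_intros)
\<comment> \<open>For \<open>c = 0\<close> all three quotients are 0, since division by zero yields
  0.\<close>
qed (use assms in \<open>auto simp: C11_deriv_def\<close>)

lemma C11_mollifier:
  assumes "0 < e"
  obtains L where "C11_deriv (mollifier e :: 'a::euclidean_space \<Rightarrow> real) (mollifier_deriv e) L"
  using C11_deriv_scale[OF C11_bump, of e] assms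
  unfolding mollifier_def[abs_def] mollifier_deriv_def[abs_def] by (metis less_imp_le)

lemma mollifier_nonneg: "0 < e \<Longrightarrow> 0 \<le> mollifier e x"
  using integral_bump_pos[of e] by (simp add: mollifier_def bump_nonneg less_imp_le)

lemma mollifier_zero:
  "0 < e \<Longrightarrow> e \<le> norm x \<Longrightarrow> mollifier e x = 0" "0 < e \<Longrightarrow> e \<le> norm x \<Longrightarrow> mollifier_deriv e x h = 0"
  by (simp_all add: mollifier_def mollifier_deriv_def bump_zero)

lemma mollifier_minus: "mollifier e (- x) = mollifier e x" "mollifier_deriv e (- x) h = - mollifier_deriv e x h"
  by (simp_all add: mollifier_def mollifier_deriv_def bump_def bump_deriv_def)

lemma integrable_mollifier: "0 < e \<Longrightarrow> integrable lborel (mollifier e)"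
  unfolding mollifier_def[abs_def] using integrable_bump[of e] by (intro integrable_divide) auto

lemma integral_mollifier: "0 < e \<Longrightarrow> (\<integral>x. mollifier e (x::'a::euclidean_space) \<partial>lborel) = 1"
  unfolding mollifier_def using integral_bump_pos[of e, where 'a = 'a] by simp

section \<open>Fubini for convolutions and L^1 approximation\<close>

lemma integrable_tensor:
  fixes f s :: "'a::euclidean_space \<Rightarrow> real"
  assumes f: "integrable lborel f" and s: "integrable lborel s"
  shows "integrable (lborel \<Otimes>\<^sub>M lborel) (\<lambda>(x, y). s x * f y)"
proof (rule lborel_pair.Fubini_integrable)
  have [measurable]: "f \<in> borel_measurable borel" "s \<in> borel_measurable borel" using f s by auto
  show "(\<lambda>(x, y). s x * f y) \<in> borel_measurable (lborel \<Otimes>\<^sub>M lborel)" by measurable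
  show "integrable lborel (\<lambda>x. \<integral>y. norm (case (x, y) of (x, y) \<Rightarrow> s x * f y) \<partial>lborel)"
    using s by (auto simp: abs_mult)
  show "AE x in lborel. integrable lborel (\<lambda>y. case (x, y) of (x, y) \<Rightarrow> s x * f y)"
    using f by auto
qed

lemma integrable_conv_tensor:
  fixes k f s :: "'a::euclidean_space \<Rightarrow> real"
  assumes k: "k \<in> borel_measurable borel" "\<And>x. \<bar>k x\<bar> \<le> C"
    and f: "integrable lborel f" and s: "integrable lborel s"
  shows "integrable (lborel \<Otimes>\<^sub>M lborel) (\<lambda>(x, y). k (x - y) * (s x * f y))"
proof (rule Bochner_Integration.integrable_bound)
  have [measurable]: "f \<in> borel_measurable borel" "s \<in> borel_measurable borel" "k \<in> borel_measurable borel"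
    using f s k by auto
  show "integrable (lborel \<Otimes>\<^sub>M lborel) (\<lambda>p. C * (case p of (x, y) \<Rightarrow> s x * f y))"
    by (intro integrable_mult_right integrable_tensor f s)
  show "(\<lambda>(x, y). k (x - y) * (s x * f y)) \<in> borel_measurable (lborel \<Otimes>\<^sub>M lborel)" by measurable
  show "AE p in lborel \<Otimes>\<^sub>M lborel. norm (case p of (x, y) \<Rightarrow> k (x - y) * (s x * f y)) \<le>
      norm (C * (case p of (x, y) \<Rightarrow> s x * f y))"
    using order_trans[OF k(2) abs_ge_self]
    by (intro AE_I2) (auto simp: abs_mult intro!: mult_right_mono)
qed

text \<open>Fubini: the adjoint of convolution with \<open>k\<close> is convolution with the
  reflected kernel.\<close>

lemma conv_duality:
  fixes k f s :: "'a::euclidean_space \<Rightarrow> real"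
  assumes k: "k \<in> borel_measurable borel" "\<And>x. \<bar>k x\<bar> \<le> C"
    and f: "integrable lborel f" and s: "integrable lborel s"
  shows "integrable lborel (\<lambda>x. conv k f x * s x)"
    and "(\<integral>x. conv k f x * s x \<partial>lborel) = (\<integral>y. f y * conv (\<lambda>z. k (- z)) s y \<partial>lborel)"
proof -
  note i = integrable_conv_tensor[OF assms]
  have 1: "(\<integral>y. k (x - y) * (s x * f y) \<partial>lborel) = conv k f x * s x" for x
    unfolding conv_def by (subst integral_mult_left_zero[symmetric]) (simp add: mult_ac)
  have 2: "(\<integral>x. k (x - y) * (s x * f y) \<partial>lborel) = f y * conv (\<lambda>z. k (- z)) s y" for y
    unfolding conv_def by (subst integral_mult_right_zero[symmetric]) (simp add: mult_ac)
  show "integrable lborel (\<lambda>x. conv k f x * s x)"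
    using lborel_pair.integrable_fst[OF i] unfolding 1 .
  show "(\<integral>x. conv k f x * s x \<partial>lborel) = (\<integral>y. f y * conv (\<lambda>z. k (- z)) s y \<partial>lborel)"
    using lborel_pair.Fubini_integral[OF i] unfolding 1 2 by simp
qed

text \<open>Young's inequality in L^1, again by Fubini and translation invariance.\<close>

lemma conv_L1:
  fixes k f :: "'a::euclidean_space \<Rightarrow> real"
  assumes k: "integrable lborel k" and f: "integrable lborel f"
  shows "integrable lborel (conv k f)"
    and "(\<integral>x. \<bar>conv k f x\<bar> \<partial>lborel) \<le> (\<integral>x. \<bar>k x\<bar> \<partial>lborel) * (\<integral>x. \<bar>f x\<bar> \<partial>lborel)"
proof -
  have [measurable]: "f \<in> borel_measurable borel" "k \<in> borel_measurable borel"
    using f k by auto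
  have tr: "(\<integral>x. \<bar>k (x - y)\<bar> \<partial>lborel) = (\<integral>x. \<bar>k x\<bar> \<partial>lborel)" for y
    using integral_lborel_translate[of "\<lambda>x. \<bar>k x\<bar>" "- y"] by simp
  have ik: "integrable lborel (\<lambda>x. k (x - y))" for y
    using integrable_lborel_translate[OF k, of "- y"] by simp
  have i: "integrable (lborel \<Otimes>\<^sub>M lborel) (\<lambda>(y, x). k (x - y) * f y)"
  proof (rule lborel_pair.Fubini_integrable)
    show "(\<lambda>(y, x). k (x - y) * f y) \<in> borel_measurable (lborel \<Otimes>\<^sub>M lborel)" by measurable
    show "integrable lborel (\<lambda>y. \<integral>x. norm (case (y, x) of (y, x) \<Rightarrow> k (x - y) * f y) \<partial>lborel)"
      using f by (simp add: abs_mult tr)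
    show "AE y in lborel. integrable lborel (\<lambda>x. case (y, x) of (y, x) \<Rightarrow> k (x - y) * f y)"
      using ik by auto
  qed
  then have i': "integrable (lborel \<Otimes>\<^sub>M lborel) (\<lambda>(y, x). \<bar>k (x - y) * f y\<bar>)"
    using integrable_norm[OF i] by (simp add: split_def)
  show c: "integrable lborel (conv k f)"
    using lborel_pair.integrable_snd[OF i] by (simp add: conv_def[abs_def])
  have "(\<integral>x. \<bar>conv k f x\<bar> \<partial>lborel) \<le> (\<integral>x. \<integral>y. \<bar>k (x - y) * f y\<bar> \<partial>lborel \<partial>lborel)"
  proof (rule integral_mono)
    show "integrable lborel (\<lambda>x. \<bar>conv k f x\<bar>)" using c by auto
    show "\<bar>conv k f x\<bar> \<le> (\<integral>y. \<bar>k (x - y) * f y\<bar> \<partial>lborel)" for x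
      using integral_norm_bound[of lborel "\<lambda>y. k (x - y) * f y"] by (simp add: conv_def)
  qed (rule lborel_pair.integrable_snd[OF i'])
  also have "\<dots> = (\<integral>y. \<integral>x. \<bar>k (x - y) * f y\<bar> \<partial>lborel \<partial>lborel)"
    by (rule lborel_pair.Fubini_integral[OF i'])
  also have "\<dots> = (\<integral>x. \<bar>k x\<bar> \<partial>lborel) * (\<integral>x. \<bar>f x\<bar> \<partial>lborel)"
    by (simp add: abs_mult tr)
  finally show "(\<integral>x. \<bar>conv k f x\<bar> \<partial>lborel) \<le> (\<integral>x. \<bar>k x\<bar> \<partial>lborel) * (\<integral>x. \<bar>f x\<bar> \<partial>lborel)" .
qed

text \<open>\<open>conv (mollifier e) f x - f x\<close> is the mean of
  \<open>f (x - z) - f x\<close> with respect to a probability density in \<open>z\<close> supported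
  in the ball of radius \<open>e\<close>; integrating first in \<open>x\<close> gives a mean of
  values of \<open>L1_modulus f\<close>.\<close>

lemma mollify_L1_le:
  fixes f :: "'a::euclidean_space \<Rightarrow> real"
  assumes e: "0 < e" and f: "integrable lborel f" and \<delta>: "\<And>z. norm z \<le> e \<Longrightarrow> L1_modulus f z \<le> \<delta>"
  shows "(\<integral>x. \<bar>conv (mollifier e) f x - f x\<bar> \<partial>lborel) \<le> \<delta>"
proof -
  define \<rho> where "\<rho> = (mollifier e :: 'a \<Rightarrow> real)"
  obtain L where C11: "C11_deriv \<rho> (mollifier_deriv e) L" using C11_mollifier[OF e] unfolding \<rho>_def .
  have \<rho>L: "\<bar>\<rho> x\<bar> \<le> L" for x using C11 by (auto simp: C11_deriv_def)
  have \<rho>0: "0 \<le> \<rho> x" for x using mollifier_nonneg[OF e] by (simp add: \<rho>_def)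
  have i\<rho>: "integrable lborel \<rho>" using integrable_mollifier[OF e] by (simp add: \<rho>_def)
  have \<rho>1: "integral\<^sup>L lborel \<rho> = 1" using integral_mollifier[OF e] by (simp add: \<rho>_def)
  have [measurable]: "f \<in> borel_measurable borel" "\<rho> \<in> borel_measurable borel" using f i\<rho> by auto
  have ft: "integrable lborel (\<lambda>x. f (x - z))" for z
    using integrable_lborel_translate[OF f, of "- z"] by simp
  have i1: "integrable (lborel \<Otimes>\<^sub>M lborel) (\<lambda>(z, x). \<rho> z * f (x - z))"
  proof (rule lborel_pair.Fubini_integrable)
    show "(\<lambda>(z, x). \<rho> z * f (x - z)) \<in> borel_measurable (lborel \<Otimes>\<^sub>M lborel)" by measurable
    have "(\<integral>x. \<bar>f (x - z)\<bar> \<partial>lborel) = (\<integral>x. \<bar>f x\<bar> \<partial>lborel)" for z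
      using integral_lborel_translate[of "\<lambda>x. \<bar>f x\<bar>" "- z"] by simp
    then show "integrable lborel (\<lambda>z. \<integral>x. norm (case (z, x) of (z, x) \<Rightarrow> \<rho> z * f (x - z)) \<partial>lborel)"
      using i\<rho> by (simp add: abs_mult)
    show "AE z in lborel. integrable lborel (\<lambda>x. case (z, x) of (z, x) \<Rightarrow> \<rho> z * f (x - z))"
      using ft by auto
  qed
  have i2: "integrable (lborel \<Otimes>\<^sub>M lborel) (\<lambda>(z, x). \<rho> z * f x)"
    by (rule integrable_tensor[OF f i\<rho>])
  have i: "integrable (lborel \<Otimes>\<^sub>M lborel) (\<lambda>(z, x). \<rho> z * \<bar>f (x - z) - f x\<bar>)"
    using integrable_norm[OF Bochner_Integration.integrable_diff[OF i1 i2]] \<rho>0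
    by (simp add: split_def abs_mult flip: right_diff_distrib)
  have iz: "integrable lborel (\<lambda>z. \<rho> z * f (x - z))" for x
    using integrable_bounded_scaleR[OF integrable_lborel_reflect[OF f, of x], of \<rho> L] \<rho>L by simp
  have eq: "conv \<rho> f x - f x = (\<integral>z. \<rho> z * (f (x - z) - f x) \<partial>lborel)" for x
  proof -
    have "conv \<rho> f x = (\<integral>z. \<rho> z * f (x - z) \<partial>lborel)"
      unfolding conv_def using integral_lborel_reflect[of "\<lambda>y. \<rho> (x - y) * f y" x] by simp
    moreover have "f x = (\<integral>z. \<rho> z * f x \<partial>lborel)" using \<rho>1 by simp
    ultimately show ?thesis
      using iz[of x] i\<rho> by (simp add: right_diff_distrib)
  qed
  have "(\<integral>x. \<bar>conv \<rho> f x - f x\<bar> \<partial>lborel) \<le> (\<integral>x. \<integral>z. \<rho> z * \<bar>f (x - z) - f x\<bar> \<partial>lborel \<partial>lborel)"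
  proof (rule integral_mono)
    show "integrable lborel (\<lambda>x. \<bar>conv \<rho> f x - f x\<bar>)"
      using conv_L1(1)[OF i\<rho> f] f by auto
    show "integrable lborel (\<lambda>x. \<integral>z. \<rho> z * \<bar>f (x - z) - f x\<bar> \<partial>lborel)"
      by (rule lborel_pair.integrable_snd[OF i])
    show "\<bar>conv \<rho> f x - f x\<bar> \<le> (\<integral>z. \<rho> z * \<bar>f (x - z) - f x\<bar> \<partial>lborel)" for x
      using integral_norm_bound[of lborel "\<lambda>z. \<rho> z * (f (x - z) - f x)"] \<rho>0 unfolding eq by (simp add: abs_mult)
  qed
  also have "\<dots> = (\<integral>z. \<integral>x. \<rho> z * \<bar>f (x - z) - f x\<bar> \<partial>lborel \<partial>lborel)"
    by (rule lborel_pair.Fubini_integral[OF i])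
  also have "\<dots> \<le> (\<integral>z. \<rho> z * \<delta> \<partial>lborel)"
  proof (rule integral_mono)
    show "integrable lborel (\<lambda>z. \<integral>x. \<rho> z * \<bar>f (x - z) - f x\<bar> \<partial>lborel)"
      by (rule lborel_pair.integrable_fst[OF i])
    show "integrable lborel (\<lambda>z. \<rho> z * \<delta>)" using i\<rho> by simp
    fix z :: 'a
    have "\<rho> z * L1_modulus f (- z) \<le> \<rho> z * \<delta>"
    proof (cases "norm z \<le> e")
      case True
      then show ?thesis using \<delta>[of "- z"] \<rho>0 by (intro mult_left_mono) auto
    next
      case False
      then show ?thesis using mollifier_zero(1)[OF e, of z] by (simp add: \<rho>_def)
    qed
    then show "(\<integral>x. \<rho> z * \<bar>f (x - z) - f x\<bar> \<partial>lborel) \<le> \<rho> z * \<delta>"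
      by (simp add: L1_modulus_def)
  qed
  also have "\<dots> = \<delta>" using \<rho>1 by simp
  finally show ?thesis by (simp add: \<rho>_def)
qed

proposition mollify_tendsto_L1:
  fixes f :: "'a::euclidean_space \<Rightarrow> real"
  assumes f: "integrable lborel f"
  shows "((\<lambda>e. \<integral>x. \<bar>conv (mollifier e) f x - f x\<bar> \<partial>lborel) \<longlongrightarrow> 0) (at_right 0)"
proof (rule tendstoI)
  fix \<epsilon> :: real assume \<epsilon>: "0 < \<epsilon>"
  have "\<forall>\<^sub>F h in at 0. L1_modulus f h < \<epsilon> / 2"
    using L1_modulus_tendsto_0[OF f] \<epsilon> by (intro order_tendstoD) auto
  then obtain d where d: "0 < d" "\<And>h. h \<noteq> 0 \<Longrightarrow> norm h < d \<Longrightarrow> L1_modulus f h < \<epsilon> / 2"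
    by (auto simp: eventually_at)
  have "L1_modulus f 0 = 0" by (simp add: L1_modulus_def)
  with d \<epsilon> have "L1_modulus f h \<le> \<epsilon> / 2" if "norm h < d" for h using that by (cases "h = 0") (auto simp: less_imp_le)
  then have "(\<integral>x. \<bar>conv (mollifier e) f x - f x\<bar> \<partial>lborel) \<le> \<epsilon> / 2" if "0 < e" "e < d" for e
    using that by (intro mollify_L1_le f) auto
  then have "dist (\<integral>x. \<bar>conv (mollifier e) f x - f x\<bar> \<partial>lborel) 0 < \<epsilon>" if "0 < e" "e < d" for e
    using that \<epsilon> by (force simp: dist_real_def)
  then show "\<forall>\<^sub>F e in at_right 0. dist (\<integral>x. \<bar>conv (mollifier e) f x - f x\<bar> \<partial>lborel) 0 < \<epsilon>"
    using d(1) unfolding eventually_at_right_field by blast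
qed

text \<open>A mean with respect to a probability density stays in the ball of radius
  \<open>C\<close>; thus mollified fields remain admissible as test fields.\<close>

lemma norm_mollify_le:
  fixes \<theta> :: "'a::euclidean_space \<Rightarrow> 'b::euclidean_space"
  assumes e: "0 < e" and \<theta>: "integrable lborel \<theta>" "\<And>x. norm (\<theta> x) \<le> C"
  shows "norm (conv (mollifier e) \<theta> x) \<le> C"
proof -
  have i: "integrable lborel (\<lambda>y. mollifier e (x - y))"
    by (rule integrable_lborel_reflect[OF integrable_mollifier[OF e]])
  have m: "(mollifier e :: 'a \<Rightarrow> real) \<in> borel_measurable borel" using integrable_mollifier[OF e] by auto
  have "norm (conv (mollifier e) \<theta> x) \<le> (\<integral>y. mollifier e (x - y) * C \<partial>lborel)"
    unfolding conv_def
  proof (rule order_trans[OF integral_norm_bound integral_mono])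
    obtain L where L: "C11_deriv (mollifier e :: 'a \<Rightarrow> real) (mollifier_deriv e) L" using C11_mollifier[OF e] .
    have "integrable lborel (\<lambda>y. mollifier e (x - y) *\<^sub>R \<theta> y)"
    proof (rule integrable_bounded_scaleR[OF \<theta>(1)])
      show "(\<lambda>y. mollifier e (x - y)) \<in> borel_measurable lborel" using i by auto
      show "\<bar>mollifier e (x - y)\<bar> \<le> L" for y using L by (auto simp: C11_deriv_def)
    qed
    then show "integrable lborel (\<lambda>y. norm (mollifier e (x - y) *\<^sub>R \<theta> y))" by (rule integrable_norm)
    show "norm (mollifier e (x - y) *\<^sub>R \<theta> y) \<le> mollifier e (x - y) * C" for y
      using mollifier_nonneg[OF e, of "x - y"] \<theta>(2)[of y] by (simp add: mult_left_mono)
  qed (use i in auto)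
  also have "\<dots> = C"
    using integral_lborel_reflect[OF m, of x] integral_mollifier[OF e, where 'a = 'a] by simp
  finally show ?thesis .
qed

lemma mollify_zero_outside:
  assumes e: "0 < e" and 0: "\<And>y. dist x y < e \<Longrightarrow> \<theta> y = 0"
  shows "conv (mollifier e) \<theta> x = 0"
proof -
  have "mollifier e (x - y) *\<^sub>R \<theta> y = 0" for y
    using mollifier_zero(1)[OF e, of "x - y"] 0[of y] by (cases "dist x y < e") (auto simp: dist_norm)
  then show ?thesis unfolding conv_def by (simp only: integral_zero)
qed

text \<open>The gradient of mollified \<open>U\<close>, paired with \<theta>, equals
  \<open>U\<close> tested with the mollified field; the sign comes from the oddness of
  \<open>mollifier_deriv\<close>. The field \<theta> is merely integrable, so it may contain factors
  such as \<open>g' (w x)\<close> that cannot be differentiated.\<close>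

proposition integral_gradient_mollify:
  fixes U :: "'a::euclidean_space \<Rightarrow> real" and \<theta> :: "'a \<Rightarrow> 'a"
  assumes e: "0 < e" and U: "integrable lborel U" and \<theta>: "integrable lborel \<theta>"
  shows "integrable lborel (\<lambda>x. \<integral>y. mollifier_deriv e (x - y) (\<theta> x) * U y \<partial>lborel)"
    and "(\<integral>x. \<integral>y. mollifier_deriv e (x - y) (\<theta> x) * U y \<partial>lborel \<partial>lborel) =
      - (\<integral>x. U x * divergence (conv (mollifier e) \<theta>) x \<partial>lborel)"
proof -
  obtain L where L: "C11_deriv (mollifier e :: 'a \<Rightarrow> real) (mollifier_deriv e) L" using C11_mollifier[OF e] .
  note C1 = C11_imp_C1_deriv[OF L]
  define k :: "'a \<Rightarrow> 'a \<Rightarrow> real" where "k b z = mollifier_deriv e z b" for b z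
  have km: "k b \<in> borel_measurable borel" for b unfolding k_def by (rule borel_measurable_C1(2)[OF C1])
  have kb: "\<bar>k b z\<bar> \<le> L * norm b" for b z using L by (auto simp: C11_deriv_def k_def)
  have \<theta>b: "integrable lborel (\<lambda>x. \<theta> x \<bullet> b)" for b using \<theta> by auto
  have iU: "integrable lborel (\<lambda>y. k b (x - y) * U y)" for b x
    using integrable_bounded_scaleR[OF U, of "\<lambda>y. k b (x - y)" "L * norm b"] kb km by simp
  have i\<theta>: "integrable lborel (\<lambda>y. k b (x - y) *\<^sub>R \<theta> y)" for b x
    using integrable_bounded_scaleR[OF \<theta>, of "\<lambda>y. k b (x - y)" "L * norm b"] kb km by simp
  have lin: "linear (mollifier_deriv e z)" for z :: 'a
    using C1_deriv_linear[OF C1] bounded_linear.linear by blast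
  \<comment> \<open>Expansion in the basis reduces the claim to the scalar kernels
    \<open>k b\<close>, to which \<open>conv_duality\<close> applies.\<close>
  have exp: "mollifier_deriv e z v = (\<Sum>b\<in>Basis. (v \<bullet> b) * k b z)" for z v :: 'a
  proof -
    have "mollifier_deriv e z v = mollifier_deriv e z (\<Sum>b\<in>Basis. (v \<bullet> b) *\<^sub>R b)"
      by (simp add: euclidean_representation)
    then show ?thesis by (simp add: linear_sum[OF lin] linear_scale[OF lin] k_def)
  qed
  have inner: "(\<integral>y. mollifier_deriv e (x - y) (\<theta> x) * U y \<partial>lborel) = (\<Sum>b\<in>Basis. conv (k b) U x * (\<theta> x \<bullet> b))" for x
  proof -
    have "(\<integral>y. mollifier_deriv e (x - y) (\<theta> x) * U y \<partial>lborel) =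
        (\<integral>y. (\<Sum>b\<in>Basis. (k b (x - y) * U y) * (\<theta> x \<bullet> b)) \<partial>lborel)"
      by (simp add: exp sum_distrib_left sum_distrib_right mult_ac)
    also have "\<dots> = (\<Sum>b\<in>Basis. (\<integral>y. (k b (x - y) * U y) * (\<theta> x \<bullet> b) \<partial>lborel))"
      using iU by (intro Bochner_Integration.integral_sum) auto
    finally show ?thesis by (simp add: conv_def)
  qed
  note dual = conv_duality[OF km kb U \<theta>b]
  show "integrable lborel (\<lambda>x. \<integral>y. mollifier_deriv e (x - y) (\<theta> x) * U y \<partial>lborel)"
    unfolding inner using dual(1) by auto
  have minus: "conv (\<lambda>z. k b (- z)) (\<lambda>x. \<theta> x \<bullet> b) y = - conv (k b) (\<lambda>x. \<theta> x \<bullet> b) y" for b y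
    unfolding conv_def k_def mollifier_minus(2) by simp
  have i\<theta>U: "integrable lborel (\<lambda>x. U x * conv (k b) (\<lambda>x. \<theta> x \<bullet> b) x)" for b
    using conv_duality(1)[OF km kb \<theta>b U, of b b] by (simp add: mult.commute)
  have div: "divergence (conv (mollifier e) \<theta>) x = (\<Sum>b\<in>Basis. conv (k b) (\<lambda>x. \<theta> x \<bullet> b) x)" for x
  proof -
    have "(\<integral>y. k b (x - y) *\<^sub>R \<theta> y \<partial>lborel) \<bullet> b = conv (k b) (\<lambda>x. \<theta> x \<bullet> b) x" for b
      unfolding conv_def using integral_inner_left[OF i\<theta>[of b x], of b] by simp
    then show ?thesis
      by (simp add: divergence_eq[OF C11_imp_C1_deriv[OF C11_deriv_conv[OF L \<theta>]]] k_def)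
  qed
  have "(\<integral>x. \<integral>y. mollifier_deriv e (x - y) (\<theta> x) * U y \<partial>lborel \<partial>lborel) =
      (\<Sum>b\<in>Basis. (\<integral>x. conv (k b) U x * (\<theta> x \<bullet> b) \<partial>lborel))"
    unfolding inner using dual(1) by (intro Bochner_Integration.integral_sum) auto
  also have "\<dots> = - (\<Sum>b\<in>Basis. (\<integral>x. U x * conv (k b) (\<lambda>x. \<theta> x \<bullet> b) x \<partial>lborel))"
    using i\<theta>U by (simp add: dual(2) minus sum_negf)
  also have "(\<Sum>b\<in>Basis. (\<integral>x. U x * conv (k b) (\<lambda>x. \<theta> x \<bullet> b) x \<partial>lborel)) =
      (\<integral>x. U x * divergence (conv (mollifier e) \<theta>) x \<partial>lborel)"
    unfolding div sum_distrib_left using i\<theta>U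
    by (intro Bochner_Integration.integral_sum[symmetric]) auto
  finally show "(\<integral>x. \<integral>y. mollifier_deriv e (x - y) (\<theta> x) * U y \<partial>lborel \<partial>lborel) =
      - (\<integral>x. U x * divergence (conv (mollifier e) \<theta>) x \<partial>lborel)" .
qed

section \<open>The Caccioppoli inequality\<close>

lemma divergence_scaleR:
  assumes a: "C1_deriv a a'" and F: "C1_deriv F F'"
  shows "divergence (\<lambda>x. a x *\<^sub>R F x) x = a x * divergence F x + a' x (F x)"
proof -
  have lin: "linear (a' x)" using C1_deriv_linear[OF a] bounded_linear.linear by blast
  have "a' x (F x) = a' x (\<Sum>b\<in>Basis. (F x \<bullet> b) *\<^sub>R b)" by (simp add: euclidean_representation)
  also have "\<dots> = (\<Sum>b\<in>Basis. a' x b * (F x \<bullet> b))"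
    by (simp add: linear_sum[OF lin] linear_scale[OF lin] mult.commute)
  finally show ?thesis
    by (simp add: divergence_eq[OF C1_deriv_scaleR[OF a F]] divergence_eq[OF F] inner_add_left
        sum.distrib sum_distrib_left)
qed

lemma divergence_add:
  assumes "C1_deriv F F'" "C1_deriv G G'"
  shows "divergence (\<lambda>x. F x + G x) x = divergence F x + divergence G x"
  by (simp add: divergence_eq[OF C1_deriv_add[OF assms]] divergence_eq[OF assms(1)]
      divergence_eq[OF assms(2)] inner_add_left sum.distrib)

text \<open>A C^1 substitute for a positive part. The bounds on \<open>g'\<close> make
  \<open>\<eta> g'\<close> a convex weight and \<open>g\<close> 1-Lipschitz, and
  \<open>g 0 = 0\<close> keeps \<open>g\<close> of an integrable function integrable.\<close>

locale truncation =
  fixes g g' :: "real \<Rightarrow> real"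
  assumes deriv: "(g has_real_derivative g' t) (at t)"
    and continuous_deriv: "continuous_on UNIV g'"
    and deriv_bounds: "0 \<le> g' t" "g' t \<le> 1"
    and nonneg: "0 \<le> g t"
    and at_0: "g 0 = 0"
begin

lemma lipschitz: "\<bar>g s - g t\<bar> \<le> \<bar>s - t\<bar>"
proof -
  have "norm (g s - g t) \<le> 1 * norm (s - t)"
    by (rule field_differentiable_bound[where S = UNIV and f' = g'])
       (use deriv deriv_bounds in \<open>auto simp: has_field_derivative_at_within\<close>)
  then show ?thesis by simp
qed

lemma abs_le: "\<bar>g t\<bar> \<le> \<bar>t\<bar>"
  using lipschitz[of t 0] at_0 by simp

lemma borel_measurable [measurable]: "g \<in> borel_measurable borel"
  using deriv by (intro borel_measurable_continuous_onI) (meson DERIV_isCont continuous_at_imp_continuous_on)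

end

locale cutoff =
  fixes \<eta> :: "'a::euclidean_space \<Rightarrow> real" and \<eta>' :: "'a \<Rightarrow> 'a \<Rightarrow> real" and K :: "'a set" and c :: real
  assumes C1: "C1_deriv \<eta> \<eta>'"
    and bounds: "0 \<le> \<eta> x" "\<eta> x \<le> 1"
    and compact: "compact K"
    and zero_outside: "x \<notin> K \<Longrightarrow> \<eta> x = 0"
    and deriv_le: "\<bar>\<eta>' x h\<bar> \<le> c * norm h"
begin

lemma deriv_zero_outside: "x \<notin> K \<Longrightarrow> \<eta>' x h = 0"
  using C1_deriv_zero_outside[OF C1 compact_imp_closed[OF compact] zero_outside] .

lemma c_nonneg: "0 \<le> c"
proof -
  obtain b :: 'a where "b \<in> Basis" using nonempty_Basis by blast
  then show ?thesis using deriv_le[of undefined b] by simp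
qed

end

locale truncation_cutoff = truncation g g' + cutoff \<eta> \<eta>' K c
  for g g' :: "real \<Rightarrow> real" and \<eta> :: "'a::euclidean_space \<Rightarrow> real" and \<eta>' :: "'a \<Rightarrow> 'a \<Rightarrow> real" and K c
begin

text \<open>For the mollified function the product rule is available, and the integral of the
  divergence of one compactly supported field vanishes. The bound \<open>M\<close> is assumed only
  for fields supported within \<open>e\<close> of \<open>K\<phi> \<union> K\<close>, because
  mollifying the combined field enlarges its support by that much.\<close>

lemma caccioppoli_mollified:
  fixes U :: "'a \<Rightarrow> real"
  assumes U: "integrable lborel U" and e: "0 < e"
    and \<phi>: "C1_deriv \<phi> \<phi>'" "\<And>x. norm (\<phi> x) \<le> 1" "compact K\<phi>" "\<And>x. x \<notin> K\<phi> \<Longrightarrow> \<phi> x = 0"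
    and \<psi>: "C1_deriv \<psi> \<psi>'" "\<And>x. norm (\<psi> x) \<le> 1"
    and M: "\<And>\<zeta>. \<zeta> \<in> C1_compact_fields {x + y |x y. x \<in> K\<phi> \<union> K \<and> y \<in> cball 0 e} \<Longrightarrow>
      (\<And>x. norm (\<zeta> x) \<le> 1) \<Longrightarrow> (\<integral>x. U x * divergence \<zeta> x \<partial>lborel) \<le> M"
  defines "w \<equiv> conv (mollifier e) U"
  shows "(\<integral>x. (w x - \<eta> x * g (w x)) * divergence \<phi> x \<partial>lborel) + (\<integral>x. \<eta> x * g (w x) * divergence \<psi> x \<partial>lborel)
      \<le> M + 2 * c * (\<integral>x. indicat_real K x * g (w x) \<partial>lborel)"
proof -
  obtain L where L: "C11_deriv (mollifier e :: 'a \<Rightarrow> real) (mollifier_deriv e) L" using C11_mollifier[OF e] .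
  define w' where "w' x h = (\<integral>y. mollifier_deriv e (x - y) h * U y \<partial>lborel)" for x h
  have w: "C1_deriv w w'"
    using C11_imp_C1_deriv[OF C11_deriv_conv[OF L U]] unfolding w_def w'_def[abs_def] by simp
  have iw: "integrable lborel w"
    unfolding w_def by (rule conv_L1(1)[OF integrable_mollifier[OF e] U])
  note cw = C1_deriv_continuous[OF w]
  have gw: "C1_deriv (\<lambda>x. g (w x)) (\<lambda>x h. g' (w x) * w' x h)"
    by (rule C1_deriv_compose_real[OF w deriv continuous_deriv])
  note cgw = C1_deriv_continuous[OF gw]
  have cg'w: "continuous_on UNIV (\<lambda>x. g' (w x))"
    using continuous_on_compose2[OF continuous_deriv cw] by simp
  have c\<eta>: "continuous_on UNIV \<eta>" by (rule C1_deriv_continuous[OF C1])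
  note c\<phi> = C1_deriv_continuous[OF \<phi>(1)] and c\<psi> = C1_deriv_continuous[OF \<psi>(1)]
  have a2: "C1_deriv (\<lambda>x. \<eta> x * g (w x)) (\<lambda>x h. \<eta> x * (g' (w x) * w' x h) + \<eta>' x h * g (w x))"
    using C1_deriv_scaleR[OF C1 gw] by simp
  note a1 = C1_deriv_diff[OF w a2]
  define \<theta> where "\<theta> x = (1 - \<eta> x * g' (w x)) *\<^sub>R \<phi> x + (\<eta> x * g' (w x)) *\<^sub>R \<psi> x" for x
  have c\<theta>: "continuous_on UNIV \<theta>"
    unfolding \<theta>_def by (intro continuous_intros c\<eta> cg'w c\<phi> c\<psi>)
  have \<theta>0: "\<theta> x = 0" if "x \<notin> K\<phi> \<union> K" for x
    using that by (simp add: \<theta>_def \<phi>(4) zero_outside)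
  have \<theta>1: "norm (\<theta> x) \<le> 1" for x
  proof -
    have s: "0 \<le> \<eta> x * g' (w x)" "\<eta> x * g' (w x) \<le> 1"
      using bounds[of x] deriv_bounds[of "w x"] by (auto simp: mult_le_one)
    have "norm (\<theta> x) \<le> norm ((1 - \<eta> x * g' (w x)) *\<^sub>R \<phi> x) + norm ((\<eta> x * g' (w x)) *\<^sub>R \<psi> x)"
      unfolding \<theta>_def by (rule norm_triangle_ineq)
    also have "\<dots> \<le> (1 - \<eta> x * g' (w x)) * 1 + (\<eta> x * g' (w x)) * 1"
      unfolding norm_scaleR using s \<phi>(2)[of x] \<psi>(2)[of x] by (intro add_mono mult_mono) auto
    finally show ?thesis by simp
  qed
  have cK: "compact (K\<phi> \<union> K)" using \<phi>(3) compact by auto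
  have i\<theta>: "integrable lborel \<theta>" by (rule integrable_continuous_compact_support[OF c\<theta> cK \<theta>0])
  \<comment> \<open>In the divergence of \<open>F\<close> the derivatives of \<open>w\<close> gather
    into \<open>w' x (\<theta> x)\<close>, which is \<open>T3\<close>, and those of \<eta> into
    \<open>T4\<close>; \<open>T1\<close> and \<open>T2\<close> are the integrands to be
    estimated.\<close>
  define F where "F x = (w x - \<eta> x * g (w x)) *\<^sub>R \<phi> x + (\<eta> x * g (w x)) *\<^sub>R \<psi> x" for x
  note dF = C1_deriv_add[OF C1_deriv_scaleR[OF a1 \<phi>(1)] C1_deriv_scaleR[OF a2 \<psi>(1)], folded F_def]
  have F0: "F x = 0" if "x \<notin> K\<phi> \<union> K" for x using that by (simp add: F_def \<phi>(4) zero_outside)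
  have iF: "integrable lborel (divergence F)"
    by (rule integrable_continuous_compact_support[OF continuous_divergence[OF dF] cK
        divergence_zero_outside[OF dF compact_imp_closed[OF cK] F0]])
  have intF: "(\<integral>x. divergence F x \<partial>lborel) = 0"
    by (rule integral_divergence_zero[OF dF cK F0])
  define T1 where "T1 x = (w x - \<eta> x * g (w x)) * divergence \<phi> x" for x
  define T2 where "T2 x = \<eta> x * g (w x) * divergence \<psi> x" for x
  define T3 where "T3 x = w' x (\<theta> x)" for x
  define T4 where "T4 x = g (w x) * \<eta>' x (\<psi> x - \<phi> x)" for x
  have div: "divergence F x = T1 x + T2 x + T3 x + T4 x" for x
  proof -
    have lw: "linear (w' x)" and l\<eta>: "linear (\<eta>' x)"
      using C1_deriv_linear[OF w] C1_deriv_linear[OF C1] bounded_linear.linear by blast+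
    have "divergence F x = (w x - \<eta> x * g (w x)) * divergence \<phi> x +
        (w' x (\<phi> x) - (\<eta> x * (g' (w x) * w' x (\<phi> x)) + \<eta>' x (\<phi> x) * g (w x))) +
        (\<eta> x * g (w x) * divergence \<psi> x + (\<eta> x * (g' (w x) * w' x (\<psi> x)) + \<eta>' x (\<psi> x) * g (w x)))"
      unfolding F_def
      by (simp only: divergence_add[OF C1_deriv_scaleR[OF a1 \<phi>(1)] C1_deriv_scaleR[OF a2 \<psi>(1)]]
          divergence_scaleR[OF a1 \<phi>(1)] divergence_scaleR[OF a2 \<psi>(1)])
    moreover have "w' x (\<theta> x) = (1 - \<eta> x * g' (w x)) * w' x (\<phi> x) + (\<eta> x * g' (w x)) * w' x (\<psi> x)"
      unfolding \<theta>_def by (simp only: linear_add[OF lw] linear_scale[OF lw] real_scaleR_def)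
    ultimately show ?thesis
      unfolding T1_def T2_def T3_def T4_def by (simp add: linear_diff[OF l\<eta>] algebra_simps)
  qed
  have i1: "integrable lborel T1"
    unfolding T1_def
    by (rule integrable_continuous_compact_support[OF _ \<phi>(3)])
       (use divergence_zero_outside[OF \<phi>(1) compact_imp_closed[OF \<phi>(3)] \<phi>(4)] in
         \<open>auto intro!: continuous_intros cw c\<eta> cgw continuous_divergence[OF \<phi>(1)]\<close>)
  have i2: "integrable lborel T2"
    unfolding T2_def
    by (rule integrable_continuous_compact_support[OF _ compact])
       (auto intro!: continuous_intros c\<eta> cgw continuous_divergence[OF \<psi>(1)] simp: zero_outside)
  have i3: "integrable lborel T3"
    unfolding T3_def w'_def by (rule integral_gradient_mollify(1)[OF e U i\<theta>])
  have "T4 = (\<lambda>x. divergence F x - (T1 x + T2 x + T3 x))" using div by (auto simp: fun_eq_iff)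
  then have i4: "integrable lborel T4" using i1 i2 i3 iF by simp
  have sum0: "integral\<^sup>L lborel T1 + integral\<^sup>L lborel T2 + integral\<^sup>L lborel T3 + integral\<^sup>L lborel T4 = 0"
    using intF unfolding div using i1 i2 i3 i4 by simp
  \<comment> \<open>The mollification passes from \<open>U\<close> to \<theta>, which yields a test
    field for \<open>U\<close> itself and brings in \<open>M\<close>.\<close>
  have "- integral\<^sup>L lborel T3 = (\<integral>x. U x * divergence (conv (mollifier e) \<theta>) x \<partial>lborel)"
    unfolding T3_def w'_def integral_gradient_mollify(2)[OF e U i\<theta>] by simp
  also have "\<dots> \<le> M"
  proof (rule M)
    let ?N = "{x + y |x y. x \<in> K\<phi> \<union> K \<and> y \<in> cball 0 e}"
    show "conv (mollifier e) \<theta> \<in> C1_compact_fields ?N"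
    proof (rule C1_compact_fieldsI[OF C11_imp_C1_deriv[OF C11_deriv_conv[OF L i\<theta>]]])
      show "compact ?N" by (rule compact_sums[OF cK compact_cball])
      show "conv (mollifier e) \<theta> x = 0" if "x \<notin> ?N" for x
      proof (rule mollify_zero_outside[OF e], rule ccontr)
        fix y assume y: "dist x y < e" "\<theta> y \<noteq> 0"
        then have "y \<in> K\<phi> \<union> K" using \<theta>0 by blast
        moreover have "x - y \<in> cball 0 e" using y(1) by (simp add: dist_norm norm_minus_commute)
        moreover have "x = y + (x - y)" by simp
        ultimately show False using that by blast
      qed
    qed simp
    show "norm (conv (mollifier e) \<theta> x) \<le> 1" for x by (rule norm_mollify_le[OF e i\<theta> \<theta>1])
  qed
  finally have T3: "- integral\<^sup>L lborel T3 \<le> M" .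
  have ig: "integrable lborel (\<lambda>x. indicat_real K x * g (w x))"
    using borel_integrable_compact[OF compact continuous_on_subset[OF cgw subset_UNIV]] by simp
  have "- T4 x \<le> 2 * c * (indicat_real K x * g (w x))" for x
  proof (cases "x \<in> K")
    case True
    \<comment> \<open>The cut-off is differentiated once against each field; this is the origin of
      the 2 in \<open>2 * c\<close>.\<close>
    have "norm (\<psi> x - \<phi> x) \<le> 2" using norm_triangle_ineq4[of "\<psi> x" "\<phi> x"] \<phi>(2)[of x] \<psi>(2)[of x] by linarith
    then have "\<bar>\<eta>' x (\<psi> x - \<phi> x)\<bar> \<le> c * 2"
      using order_trans[OF deriv_le mult_left_mono[OF _ c_nonneg]] by blast
    then have "g (w x) * - \<eta>' x (\<psi> x - \<phi> x) \<le> g (w x) * (c * 2)"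
      using nonneg[of "w x"] by (intro mult_left_mono) auto
    then show ?thesis using True by (simp add: T4_def mult_ac)
  qed (simp add: T4_def deriv_zero_outside)
  then have "(\<integral>x. - T4 x \<partial>lborel) \<le> (\<integral>x. 2 * c * (indicat_real K x * g (w x)) \<partial>lborel)"
    using i4 ig by (intro integral_mono) auto
  then have "- integral\<^sup>L lborel T4 \<le> 2 * c * (\<integral>x. indicat_real K x * g (w x) \<partial>lborel)" by simp
  then have "integral\<^sup>L lborel T1 + integral\<^sup>L lborel T2 \<le> M + 2 * c * (\<integral>x. indicat_real K x * g (w x) \<partial>lborel)"
    using T3 sum0 by linarith
  then show ?thesis by (simp add: T1_def[abs_def] T2_def[abs_def])
qed

text \<open>The mollification radius tends to zero. All three integrands are combined into one
  function \<open>G x t\<close> that is Lipschitz in \<open>t\<close> uniformly in \<open>x\<close>,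
  so convergence in L^1 alone carries the estimate to the limit.\<close>

proposition caccioppoli:
  fixes U :: "'a \<Rightarrow> real"
  assumes U: "integrable lborel U" and \<Omega>: "open \<Omega>" "K \<subseteq> \<Omega>"
    and M: "\<And>\<zeta>. \<zeta> \<in> C1_compact_fields \<Omega> \<Longrightarrow> (\<And>x. norm (\<zeta> x) \<le> 1) \<Longrightarrow>
      (\<integral>x. U x * divergence \<zeta> x \<partial>lborel) \<le> M"
    and \<phi>: "\<phi> \<in> C1_compact_fields \<Omega>" "\<And>x. norm (\<phi> x) \<le> 1"
    and \<psi>: "C1_deriv \<psi> \<psi>'" "\<And>x. norm (\<psi> x) \<le> 1"
  shows "(\<integral>x. (U x - \<eta> x * g (U x)) * divergence \<phi> x \<partial>lborel) + (\<integral>x. \<eta> x * g (U x) * divergence \<psi> x \<partial>lborel)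
      \<le> M + 2 * c * (\<integral>x. indicat_real K x * g (U x) \<partial>lborel)"
proof -
  obtain \<phi>' K\<phi> where \<phi>': "C1_deriv \<phi> \<phi>'" and K\<phi>: "compact K\<phi>" "K\<phi> \<subseteq> \<Omega>" "\<And>x. x \<notin> K\<phi> \<Longrightarrow> \<phi> x = 0"
    using C1_compact_fieldsE[OF \<phi>(1)] by metis
  have cK: "compact (K\<phi> \<union> K)" using K\<phi>(1) compact by auto
  \<comment> \<open>For radii below \<open>d\<close> the enlarged supports stay in \<Omega>, where
    \<open>M\<close> is available.\<close>
  obtain d where d: "0 < d" "(\<Union>x\<in>K\<phi> \<union> K. ball x d) \<subseteq> \<Omega>"
    using compact_subset_open_imp_ball_epsilon_subset[OF cK \<Omega>(1)] K\<phi>(2) \<Omega>(2) by blast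
  have sub: "{x + y |x y. x \<in> K\<phi> \<union> K \<and> y \<in> cball 0 e} \<subseteq> \<Omega>" if "e < d" for e
  proof
    fix z assume "z \<in> {x + y |x y. x \<in> K\<phi> \<union> K \<and> y \<in> cball 0 e}"
    then obtain x y where "z = x + y" "x \<in> K\<phi> \<union> K" "norm y \<le> e" by auto
    then have "z \<in> ball x d" using that by (simp add: dist_norm)
    then show "z \<in> \<Omega>" using d(2) \<open>x \<in> K\<phi> \<union> K\<close> by blast
  qed
  define A where "A = divergence \<phi>"
  define B where "B x = \<eta> x * divergence \<psi> x" for x
  have cA: "continuous_on UNIV A" unfolding A_def by (rule continuous_divergence[OF \<phi>'])
  have cB: "continuous_on UNIV B"
    unfolding B_def by (intro continuous_intros C1_deriv_continuous[OF C1] continuous_divergence[OF \<psi>(1)])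
  obtain CA where CA: "0 \<le> CA" "\<And>x. norm (A x) \<le> CA"
    using continuous_compact_support_bounded[OF cA K\<phi>(1)]
      divergence_zero_outside[OF \<phi>' compact_imp_closed[OF K\<phi>(1)] K\<phi>(3)] unfolding A_def by metis
  obtain CB where CB: "0 \<le> CB" "\<And>x. norm (B x) \<le> CB"
    using continuous_compact_support_bounded[OF cB compact] zero_outside unfolding B_def by auto
  define G where "G x t = (t - \<eta> x * g t) * A x + g t * B x - 2 * c * (indicat_real K x * g t)" for x t
  \<comment> \<open>\<open>CA\<close> enters twice, through \<open>t\<close> and through
    \<open>\<eta> x * g t\<close>; \<open>CB\<close> and \<open>2 * c\<close> come from the other
    two terms, \<open>g\<close> being 1-Lipschitz.\<close>
  define C where "C = 2 * CA + CB + 2 * c"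
  have GL: "\<bar>G x s - G x t\<bar> \<le> C * \<bar>s - t\<bar>" for x s t
  proof -
    have "G x s - G x t = (s - t) * A x - (g s - g t) * (\<eta> x * A x) + (g s - g t) * B x - (g s - g t) * (2 * c * indicat_real K x)"
      by (simp add: G_def algebra_simps)
    also have "\<bar>\<dots>\<bar> \<le> \<bar>(s - t) * A x\<bar> + \<bar>(g s - g t) * (\<eta> x * A x)\<bar> + \<bar>(g s - g t) * B x\<bar> + \<bar>(g s - g t) * (2 * c * indicat_real K x)\<bar>"
      by linarith
    also have "\<dots> \<le> \<bar>s - t\<bar> * CA + \<bar>s - t\<bar> * CA + \<bar>s - t\<bar> * CB + \<bar>s - t\<bar> * (2 * c)"
    proof (intro add_mono)
      have "\<bar>\<eta> x * A x\<bar> \<le> 1 * CA"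
        unfolding abs_mult using bounds[of x] CA(2)[of x] by (intro mult_mono) auto
      then show "\<bar>(g s - g t) * (\<eta> x * A x)\<bar> \<le> \<bar>s - t\<bar> * CA"
        unfolding abs_mult[of "g s - g t"] using lipschitz[of s t] by (intro mult_mono) auto
      show "\<bar>(s - t) * A x\<bar> \<le> \<bar>s - t\<bar> * CA"
        unfolding abs_mult using CA(2)[of x] by (intro mult_mono) auto
      show "\<bar>(g s - g t) * B x\<bar> \<le> \<bar>s - t\<bar> * CB"
        unfolding abs_mult using lipschitz[of s t] CB(2)[of x] by (intro mult_mono) auto
      show "\<bar>(g s - g t) * (2 * c * indicat_real K x)\<bar> \<le> \<bar>s - t\<bar> * (2 * c)"
      proof -
        have "\<bar>2 * c * indicat_real K x\<bar> \<le> 2 * c" using c_nonneg by (auto simp: indicator_def)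
        then show ?thesis
          unfolding abs_mult[of "g s - g t"] using lipschitz[of s t] by (intro mult_mono) auto
      qed
    qed
    also have "\<dots> = C * \<bar>s - t\<bar>" by (simp add: C_def algebra_simps)
    finally show ?thesis .
  qed
  have [measurable]: "A \<in> borel_measurable borel" "B \<in> borel_measurable borel" "\<eta> \<in> borel_measurable borel" "K \<in> sets borel"
    using cA cB borel_measurable_C1[OF C1] borel_compact[OF compact] by (auto intro: borel_measurable_continuous_onI)
  have parts: "integrable lborel (\<lambda>x. (v x - \<eta> x * g (v x)) * divergence \<phi> x)"
    "integrable lborel (\<lambda>x. \<eta> x * g (v x) * divergence \<psi> x)"
    "integrable lborel (\<lambda>x. indicat_real K x * g (v x))" if v: "integrable lborel v" for v
  proof -
    have [measurable]: "v \<in> borel_measurable borel" using v by auto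
    have gv: "integrable lborel (\<lambda>x. g (v x))"
      by (rule Bochner_Integration.integrable_bound[OF v]) (use abs_le in auto)
    have e2: "integrable lborel (\<lambda>x. \<eta> x * g (v x))"
      by (rule Bochner_Integration.integrable_bound[OF gv])
         (use bounds in \<open>auto simp: abs_mult intro!: mult_left_le_one_le\<close>)
    have "integrable lborel (\<lambda>x. A x *\<^sub>R (v x - \<eta> x * g (v x)))"
      by (rule integrable_bounded_scaleR[where C = CA]) (use v e2 CA in auto)
    then show "integrable lborel (\<lambda>x. (v x - \<eta> x * g (v x)) * divergence \<phi> x)"
      by (simp add: A_def mult.commute)
    have "integrable lborel (\<lambda>x. B x *\<^sub>R g (v x))"
      by (rule integrable_bounded_scaleR[where C = CB]) (use gv CB in auto)
    then show "integrable lborel (\<lambda>x. \<eta> x * g (v x) * divergence \<psi> x)"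
      by (simp add: B_def mult_ac)
    show "integrable lborel (\<lambda>x. indicat_real K x * g (v x))"
      by (rule Bochner_Integration.integrable_bound[OF gv]) (auto simp: indicator_def)
  qed
  have Gint: "integrable lborel (\<lambda>x. G x (v x))"
    "(\<integral>x. G x (v x) \<partial>lborel) = (\<integral>x. (v x - \<eta> x * g (v x)) * divergence \<phi> x \<partial>lborel) +
      (\<integral>x. \<eta> x * g (v x) * divergence \<psi> x \<partial>lborel) - 2 * c * (\<integral>x. indicat_real K x * g (v x) \<partial>lborel)"
    if v: "integrable lborel v" for v
  proof -
    have eq: "G x (v x) = (v x - \<eta> x * g (v x)) * divergence \<phi> x + \<eta> x * g (v x) * divergence \<psi> x
        - 2 * c * (indicat_real K x * g (v x))" for x
      by (simp add: G_def A_def B_def)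
    show "integrable lborel (\<lambda>x. G x (v x))" unfolding eq using parts[OF v] by auto
    show "(\<integral>x. G x (v x) \<partial>lborel) = (\<integral>x. (v x - \<eta> x * g (v x)) * divergence \<phi> x \<partial>lborel) +
      (\<integral>x. \<eta> x * g (v x) * divergence \<psi> x \<partial>lborel) - 2 * c * (\<integral>x. indicat_real K x * g (v x) \<partial>lborel)"
      unfolding eq using parts[OF v] by simp
  qed
  define w where "w e = conv (mollifier e) U" for e
  have iw: "integrable lborel (w e)" if "0 < e" for e
    unfolding w_def by (rule conv_L1(1)[OF integrable_mollifier[OF that] U])
  have "(\<integral>x. G x (U x) \<partial>lborel) \<le> M + C * (\<integral>x. \<bar>w e x - U x\<bar> \<partial>lborel)" if e: "0 < e" "e < d" for e
  proof -
    have "(\<integral>x. G x (U x) \<partial>lborel) - (\<integral>x. G x (w e x) \<partial>lborel) = (\<integral>x. G x (U x) - G x (w e x) \<partial>lborel)"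
      using Gint(1)[OF U] Gint(1)[OF iw[OF e(1)]] by simp
    also have "\<dots> \<le> (\<integral>x. C * \<bar>w e x - U x\<bar> \<partial>lborel)"
    proof (rule integral_mono)
      show "G x (U x) - G x (w e x) \<le> C * \<bar>w e x - U x\<bar>" for x
        using GL[of x "U x" "w e x"] by (simp add: abs_minus_commute)
    qed (use Gint(1)[OF U] Gint(1)[OF iw[OF e(1)]] iw[OF e(1)] U in auto)
    also have "\<dots> = C * (\<integral>x. \<bar>w e x - U x\<bar> \<partial>lborel)" by simp
    finally have 1: "(\<integral>x. G x (U x) \<partial>lborel) \<le> (\<integral>x. G x (w e x) \<partial>lborel) + C * (\<integral>x. \<bar>w e x - U x\<bar> \<partial>lborel)" by simp
    have "(\<integral>x. (w e x - \<eta> x * g (w e x)) * divergence \<phi> x \<partial>lborel) +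
        (\<integral>x. \<eta> x * g (w e x) * divergence \<psi> x \<partial>lborel) \<le> M + 2 * c * (\<integral>x. indicat_real K x * g (w e x) \<partial>lborel)"
      unfolding w_def
    proof (rule caccioppoli_mollified[OF U e(1) \<phi>' \<phi>(2) K\<phi>(1,3) \<psi>])
      fix \<zeta> assume \<zeta>: "\<zeta> \<in> C1_compact_fields {x + y |x y. x \<in> K\<phi> \<union> K \<and> y \<in> cball 0 e}" "\<And>x. norm (\<zeta> x) \<le> 1"
      have "\<zeta> \<in> C1_compact_fields \<Omega>"
        using \<zeta>(1) sub[OF e(2)] unfolding C1_compact_fields_def by blast
      then show "(\<integral>x. U x * divergence \<zeta> x \<partial>lborel) \<le> M" by (rule M[OF _ \<zeta>(2)])
    qed
    then have "(\<integral>x. G x (w e x) \<partial>lborel) \<le> M" unfolding Gint(2)[OF iw[OF e(1)]] by linarith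
    then show ?thesis using 1 by linarith
  qed
  then have "\<forall>\<^sub>F e in at_right 0. (\<integral>x. G x (U x) \<partial>lborel) \<le> M + C * (\<integral>x. \<bar>w e x - U x\<bar> \<partial>lborel)"
    using d(1) unfolding eventually_at_right_field by blast
  moreover have "((\<lambda>e. M + C * (\<integral>x. \<bar>w e x - U x\<bar> \<partial>lborel)) \<longlongrightarrow> M + C * 0) (at_right 0)"
    unfolding w_def by (intro tendsto_intros mollify_tendsto_L1 U)
  ultimately have "(\<integral>x. G x (U x) \<partial>lborel) \<le> M + C * 0"
    by (intro tendsto_lowerbound) auto
  then show ?thesis unfolding Gint(2)[OF U] by linarith
qed

end

section \<open>From C^1 truncations to the positive part\<close>

lemma truncation_sqrt:
  assumes d: "0 < d" and k: "0 \<le> k"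
  shows "truncation (\<lambda>t. sqrt ((max 0 (t - k))\<^sup>2 + d\<^sup>2) - d) (\<lambda>t. max 0 (t - k) / sqrt ((max 0 (t - k))\<^sup>2 + d\<^sup>2))"
proof
  fix t :: real
  have pos: "0 < (max 0 (t - k))\<^sup>2 + d\<^sup>2" for t using d by (simp add: add_nonneg_pos)
  have "((\<lambda>t. (max 0 (t - k))\<^sup>2) has_real_derivative 2 * max 0 (t - k) * 1) (at t)"
    by (rule DERIV_chain2[OF has_real_derivative_max_0_square]) (auto intro!: derivative_eq_intros)
  then have 1: "((\<lambda>t. (max 0 (t - k))\<^sup>2 + d\<^sup>2) has_real_derivative 2 * max 0 (t - k)) (at t)"
    using DERIV_add[OF _ DERIV_const] by fastforce
  show "((\<lambda>t. sqrt ((max 0 (t - k))\<^sup>2 + d\<^sup>2) - d) has_real_derivative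
      max 0 (t - k) / sqrt ((max 0 (t - k))\<^sup>2 + d\<^sup>2)) (at t)"
    using DERIV_diff[OF DERIV_chain2[OF DERIV_real_sqrt[OF pos] 1] DERIV_const[of d]]
    by (simp add: field_simps)
  show "continuous_on UNIV (\<lambda>t. max 0 (t - k) / sqrt ((max 0 (t - k))\<^sup>2 + d\<^sup>2))"
    using pos by (intro continuous_intros) (auto simp: less_le)
  show "0 \<le> max 0 (t - k) / sqrt ((max 0 (t - k))\<^sup>2 + d\<^sup>2)" by simp
  have "max 0 (t - k) \<le> sqrt ((max 0 (t - k))\<^sup>2 + d\<^sup>2)" by (rule real_le_rsqrt) simp
  then show "max 0 (t - k) / sqrt ((max 0 (t - k))\<^sup>2 + d\<^sup>2) \<le> 1"
    using pos[of t] by (simp add: divide_le_eq_1)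
  have "d \<le> sqrt ((max 0 (t - k))\<^sup>2 + d\<^sup>2)" by (rule real_le_rsqrt) simp
  then show "0 \<le> sqrt ((max 0 (t - k))\<^sup>2 + d\<^sup>2) - d" by simp
  show "sqrt ((max 0 (0 - k))\<^sup>2 + d\<^sup>2) - d = 0" using k d by simp
qed

lemma sqrt_truncation_bounds:
  fixes p d :: real
  assumes "0 < d" "0 \<le> p"
  shows "sqrt (p\<^sup>2 + d\<^sup>2) - d \<le> p" "p - d \<le> sqrt (p\<^sup>2 + d\<^sup>2) - d"
proof -
  have "sqrt (p\<^sup>2 + d\<^sup>2) \<le> p + d"
    using assms by (intro real_le_lsqrt) (auto simp: power2_sum)
  then show "sqrt (p\<^sup>2 + d\<^sup>2) - d \<le> p" by simp
  have "p \<le> sqrt (p\<^sup>2 + d\<^sup>2)" by (rule real_le_rsqrt) simp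
  then show "p - d \<le> sqrt (p\<^sup>2 + d\<^sup>2) - d" by simp
qed

lemma C1_deriv_const: "C1_deriv (\<lambda>x. u) (\<lambda>x h. 0)"
  by (simp add: C1_deriv_def)

lemma divergence_const: "divergence (\<lambda>x. u) x = 0"
  by (simp add: divergence_eq[OF C1_deriv_const])

lemma C1_deriv_minus: "C1_deriv f f' \<Longrightarrow> C1_deriv (\<lambda>x. - f x) (\<lambda>x h. - f' x h)"
  by (auto simp: C1_deriv_def intro!: has_derivative_minus continuous_intros)

lemma divergence_minus: "C1_deriv f f' \<Longrightarrow> divergence (\<lambda>x. - f x) x = - divergence f x"
  by (simp add: divergence_eq[OF C1_deriv_minus] divergence_eq sum_negf)

lemma C1_compact_fields_zero: "(\<lambda>x. 0) \<in> C1_compact_fields \<Omega>"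
  by (rule C1_compact_fieldsI[OF C1_deriv_const, of "{}"]) auto

lemma C1_compact_fields_minus:
  assumes "\<zeta> \<in> C1_compact_fields \<Omega>"
  shows "(\<lambda>x. - \<zeta> x) \<in> C1_compact_fields \<Omega>" "divergence (\<lambda>x. - \<zeta> x) x = - divergence \<zeta> x"
proof -
  obtain \<zeta>' K where \<zeta>: "C1_deriv \<zeta> \<zeta>'" "compact K" "K \<subseteq> \<Omega>" "\<And>x. x \<notin> K \<Longrightarrow> \<zeta> x = 0"
    using C1_compact_fieldsE[OF assms] by metis
  show "(\<lambda>x. - \<zeta> x) \<in> C1_compact_fields \<Omega>"
    by (rule C1_compact_fieldsI[OF C1_deriv_minus[OF \<zeta>(1)] \<zeta>(2,3)]) (simp add: \<zeta>(4))
  show "divergence (\<lambda>x. - \<zeta> x) x = - divergence \<zeta> x" by (rule divergence_minus[OF \<zeta>(1)])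
qed

text \<open>The variational content of the hypotheses, for a Borel representative \<open>U\<close> that is defined on
  the whole space; \<open>M\<close> is the total variation of \<open>u\<close> in \<open>\<Omega>\<close>.\<close>

locale minimizer =
  fixes \<Omega> :: "'a::euclidean_space set" and U :: "'a \<Rightarrow> real" and M :: real
  assumes open_domain: "open \<Omega>"
    and integrable: "integrable lborel U"
    and variation_le: "\<zeta> \<in> C1_compact_fields \<Omega> \<Longrightarrow> (\<And>x. norm (\<zeta> x) \<le> 1) \<Longrightarrow>
      (\<integral>x. U x * divergence \<zeta> x \<partial>lborel) \<le> M"
    and minimal: "integrable lborel W \<Longrightarrow> compact K \<Longrightarrow> K \<subseteq> \<Omega> \<Longrightarrow> (\<And>x. x \<notin> K \<Longrightarrow> W x = 0) \<Longrightarrow>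
      (\<And>\<zeta>. \<zeta> \<in> C1_compact_fields \<Omega> \<Longrightarrow> (\<And>x. norm (\<zeta> x) \<le> 1) \<Longrightarrow> (\<integral>x. W x * divergence \<zeta> x \<partial>lborel) \<le> C) \<Longrightarrow>
      (\<And>\<zeta>. \<zeta> \<in> C1_compact_fields \<Omega> \<Longrightarrow> (\<And>x. norm (\<zeta> x) \<le> 1) \<Longrightarrow> (\<integral>x. (U x + W x) * divergence \<zeta> x \<partial>lborel) \<le> S) \<Longrightarrow>
      M \<le> S"
begin

text \<open>The competitor is \<open>U - \<eta> g(U)\<close>. With \<psi> fixed, the Caccioppoli
  estimate holds for every test field in the first slot and so bounds the variation of the
  competitor by \<open>M + ?I - ?J\<close>; minimality says that this is at least
  \<open>M\<close>.\<close>

lemma truncated_variation_le: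
  assumes tc: "truncation_cutoff g g' \<eta> \<eta>' K c" and K: "K \<subseteq> \<Omega>"
    and \<psi>: "C1_deriv \<psi> \<psi>'" "\<And>x. norm (\<psi> x) \<le> 1"
  shows "(\<integral>x. \<eta> x * g (U x) * divergence \<psi> x \<partial>lborel) \<le> 2 * c * (\<integral>x. indicat_real K x * g (U x) \<partial>lborel)"
proof -
  interpret truncation_cutoff g g' \<eta> \<eta>' K c by (rule tc)
  let ?I = "2 * c * (\<integral>x. indicat_real K x * g (U x) \<partial>lborel)"
  let ?J = "\<integral>x. \<eta> x * g (U x) * divergence \<psi> x \<partial>lborel"
  have [measurable]: "U \<in> borel_measurable borel" "\<eta> \<in> borel_measurable borel"
    using integrable borel_measurable_C1[OF C1] by auto
  note cacc = caccioppoli[OF integrable open_domain K variation_le]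
  have "M \<le> M + ?I - ?J"
  proof (rule minimal[where W = "\<lambda>x. - (\<eta> x * g (U x))" and K = K and C = "M + ?I"])
    show "integrable lborel (\<lambda>x. - (\<eta> x * g (U x)))"
    proof (rule Bochner_Integration.integrable_bound[OF integrable])
      have "\<bar>\<eta> x\<bar> * \<bar>g (U x)\<bar> \<le> 1 * \<bar>U x\<bar>" for x
        using bounds[of x] abs_le[of "U x"] by (intro mult_mono) auto
      then show "AE x in lborel. norm (- (\<eta> x * g (U x))) \<le> norm (U x)" by (simp add: abs_mult)
    qed measurable
    show "compact K" by (rule compact)
    show "K \<subseteq> \<Omega>" by (rule K)
    show "- (\<eta> x * g (U x)) = 0" if "x \<notin> K" for x using zero_outside[OF that] by simp
  next
    fix \<zeta> assume \<zeta>: "\<zeta> \<in> C1_compact_fields \<Omega>" "\<And>x. norm (\<zeta> x) \<le> 1"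
    obtain \<zeta>' where \<zeta>': "C1_deriv \<zeta> \<zeta>'" using C1_compact_fieldsE[OF \<zeta>(1)] by metis
    \<comment> \<open>The zero field in the first slot and the negated test field in the second show
      that the perturbation has finite variation, as a competitor must.\<close>
    have "(\<integral>x. (U x - \<eta> x * g (U x)) * divergence (\<lambda>x. 0) x \<partial>lborel) +
        (\<integral>x. \<eta> x * g (U x) * divergence (\<lambda>x. - \<zeta> x) x \<partial>lborel) \<le> M + ?I"
      by (rule cacc[OF _ _ C1_compact_fields_zero _ C1_deriv_minus[OF \<zeta>']]) (use \<zeta> in auto)
    then show "(\<integral>x. - (\<eta> x * g (U x)) * divergence \<zeta> x \<partial>lborel) \<le> M + ?I"
      by (simp add: divergence_const divergence_minus[OF \<zeta>'])
    show "(\<integral>x. (U x + - (\<eta> x * g (U x))) * divergence \<zeta> x \<partial>lborel) \<le> M + ?I - ?J"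
      using cacc[OF _ _ \<zeta> \<psi>] by simp
  qed
  then show ?thesis by simp
qed

text \<open>The square root truncation is within \<open>d\<close> of the positive part, so replacing
  one by the other costs at most \<open>d\<close> times the integral of
  \<open>\<bar>\<eta> x * divergence \<psi> x\<bar>\<close>; then \<open>d\<close> tends to
  zero.\<close>

proposition energy_estimate:
  assumes cut: "cutoff \<eta> \<eta>' K c" and K: "K \<subseteq> \<Omega>" and k: "0 \<le> k"
    and \<psi>: "C1_deriv \<psi> \<psi>'" "\<And>x. norm (\<psi> x) \<le> 1"
  shows "(\<integral>x. \<eta> x * max 0 (U x - k) * divergence \<psi> x \<partial>lborel) \<le> 2 * c * (\<integral>x. indicat_real K x * max 0 (U x - k) \<partial>lborel)"
proof -
  interpret cutoff \<eta> \<eta>' K c by (rule cut)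
  define B where "B x = \<eta> x * divergence \<psi> x" for x
  have cB: "continuous_on UNIV B"
    unfolding B_def by (intro continuous_intros C1_deriv_continuous[OF C1] continuous_divergence[OF \<psi>(1)])
  have B0: "B x = 0" if "x \<notin> K" for x using zero_outside[OF that] by (simp add: B_def)
  have iB: "integrable lborel B" by (rule integrable_continuous_compact_support[OF cB compact B0])
  obtain CB where CB: "0 \<le> CB" "\<And>x. norm (B x) \<le> CB"
    using continuous_compact_support_bounded[OF cB compact B0] by auto
  have [measurable]: "U \<in> borel_measurable borel" "B \<in> borel_measurable borel" "K \<in> sets borel"
    using integrable cB borel_compact[OF compact] by (auto intro: borel_measurable_continuous_onI)
  have ip: "integrable lborel (\<lambda>x. max 0 (U x - k))"
    by (rule Bochner_Integration.integrable_bound[OF integrable]) (use k in auto)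
  have iBp: "integrable lborel (\<lambda>x. B x * max 0 (U x - k))"
    using integrable_bounded_scaleR[OF ip, of B CB] CB by simp
  have iKp: "integrable lborel (\<lambda>x. indicat_real K x * max 0 (U x - k))"
    by (rule Bochner_Integration.integrable_bound[OF ip]) (auto simp: indicator_def)
  define D where "D = (\<integral>x. \<bar>B x\<bar> \<partial>lborel)"
  have D0: "0 \<le> D" unfolding D_def by simp
  have main: "(\<integral>x. B x * max 0 (U x - k) \<partial>lborel) \<le> 2 * c * (\<integral>x. indicat_real K x * max 0 (U x - k) \<partial>lborel) + d * D"
    if d: "0 < d" for d
  proof -
    define g where "g t = sqrt ((max 0 (t - k))\<^sup>2 + d\<^sup>2) - d" for t
    have gp: "g t \<le> max 0 (t - k)" "max 0 (t - k) - d \<le> g t" for t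
      unfolding g_def using sqrt_truncation_bounds[OF d, of "max 0 (t - k)"] by auto
    interpret truncation g "\<lambda>t. max 0 (t - k) / sqrt ((max 0 (t - k))\<^sup>2 + d\<^sup>2)"
      unfolding g_def by (rule truncation_sqrt[OF d k])
    have tc: "truncation_cutoff g (\<lambda>t. max 0 (t - k) / sqrt ((max 0 (t - k))\<^sup>2 + d\<^sup>2)) \<eta> \<eta>' K c" ..
    have ig: "integrable lborel (\<lambda>x. g (U x))"
      by (rule Bochner_Integration.integrable_bound[OF integrable]) (use abs_le in auto)
    have iBg: "integrable lborel (\<lambda>x. B x * g (U x))"
      using integrable_bounded_scaleR[OF ig, of B CB] CB by simp
    have iKg: "integrable lborel (\<lambda>x. indicat_real K x * g (U x))"
      by (rule Bochner_Integration.integrable_bound[OF ig]) (auto simp: indicator_def)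
    have "(\<integral>x. B x * max 0 (U x - k) \<partial>lborel) - (\<integral>x. B x * g (U x) \<partial>lborel)
        = (\<integral>x. B x * max 0 (U x - k) - B x * g (U x) \<partial>lborel)"
      using iBp iBg by simp
    also have "\<dots> \<le> (\<integral>x. d * \<bar>B x\<bar> \<partial>lborel)"
    proof (rule integral_mono)
      fix x
      have "B x * max 0 (U x - k) - B x * g (U x) \<le> \<bar>B x\<bar> * \<bar>max 0 (U x - k) - g (U x)\<bar>"
        by (metis abs_ge_self abs_mult right_diff_distrib)
      also have "\<dots> \<le> \<bar>B x\<bar> * d" using gp[of "U x"] by (intro mult_left_mono) auto
      finally show "B x * max 0 (U x - k) - B x * g (U x) \<le> d * \<bar>B x\<bar>" by (simp add: mult.commute)
    qed (use iBp iBg iB in auto)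
    also have "\<dots> = d * D" by (simp add: D_def)
    finally have 1: "(\<integral>x. B x * max 0 (U x - k) \<partial>lborel) \<le> (\<integral>x. B x * g (U x) \<partial>lborel) + d * D" by simp
    have "(\<integral>x. B x * g (U x) \<partial>lborel) \<le> 2 * c * (\<integral>x. indicat_real K x * g (U x) \<partial>lborel)"
      using truncated_variation_le[OF tc K \<psi>] by (simp add: B_def mult_ac)
    also have "\<dots> \<le> 2 * c * (\<integral>x. indicat_real K x * max 0 (U x - k) \<partial>lborel)"
      using iKp iKg gp(1) c_nonneg by (intro mult_left_mono integral_mono) auto
    finally show ?thesis using 1 by simp
  qed
  have "(\<integral>x. B x * max 0 (U x - k) \<partial>lborel) \<le> 2 * c * (\<integral>x. indicat_real K x * max 0 (U x - k) \<partial>lborel)"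
  proof (rule field_le_epsilon)
    fix \<epsilon> :: real assume \<epsilon>: "0 < \<epsilon>"
    have "\<epsilon> / (D + 1) * D \<le> \<epsilon>" using \<epsilon> D0 by (simp add: field_simps)
    moreover have "0 < \<epsilon> / (D + 1)" using \<epsilon> D0 by simp
    ultimately show "(\<integral>x. B x * max 0 (U x - k) \<partial>lborel) \<le> 2 * c * (\<integral>x. indicat_real K x * max 0 (U x - k) \<partial>lborel) + \<epsilon>"
      using main[of "\<epsilon> / (D + 1)"] by linarith
  qed
  then show ?thesis by (simp add: B_def mult_ac)
qed

end

section \<open>An isoperimetric estimate\<close>

lemma C11_deriv_reflect:
  assumes "C11_deriv f f' L"
  shows "C11_deriv (\<lambda>x. f (- x)) (\<lambda>x h. - f' (- x) h) L"
proof -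
  have "((\<lambda>x. f (- x)) has_derivative (\<lambda>h. - f' (- x) h)) (at x)" for x
  proof -
    have f: "(f has_derivative f' (- x)) (at (- x))" using assms by (auto simp: C11_deriv_def)
    have "((\<lambda>x. - x) has_derivative (\<lambda>h. - h)) (at x)" by (intro derivative_intros)
    from has_derivative_compose[OF this f]
    show ?thesis using linear_neg[OF has_derivative_linear[OF f]] by simp
  qed
  moreover have "norm (- f' (- x) h + f' (- y) h) \<le> L * norm (x - y) * norm h" for x y h
  proof -
    have "norm (f' (- y) h - f' (- x) h) \<le> L * norm (- y - - x) * norm h"
      using assms unfolding C11_deriv_def by blast
    then show ?thesis by simp
  qed
  ultimately show ?thesis using assms by (auto simp: C11_deriv_def)
qed

lemma C1_deriv_shift:
  assumes "C1_deriv f f'"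
  shows "C1_deriv (\<lambda>x. f (x - z)) (\<lambda>x h. f' (x - z) h)"
  unfolding C1_deriv_def
proof (intro conjI allI)
  show "((\<lambda>x. f (x - z)) has_derivative f' (x - z)) (at x)" for x
  proof -
    have "((\<lambda>x. x - z) has_derivative (\<lambda>h. h)) (at x)" by (auto intro!: derivative_eq_intros)
    from has_derivative_compose[OF this C1_deriv_has_derivative[OF assms]] show ?thesis .
  qed
  show "continuous_on UNIV (\<lambda>x. f' (x - z) h)" for h
    by (rule continuous_on_compose2[OF C1_deriv_continuous_deriv[OF assms]]) (auto intro: continuous_intros)
qed

text \<open>Testing the weak derivative of \<open>W\<close> with translates of a mollified indicator function of \<open>A\<close> bounds
  the rate at which the mass of \<open>W\<close> leaves \<open>A\<close> under translation; on average over the translations in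
  a ball much larger than \<open>A\<close>, most of the mass leaves.\<close>

proposition isoperimetric_estimate:
  fixes W :: "'a::euclidean_space \<Rightarrow> real"
  assumes W: "integrable lborel W" "\<And>x. 0 \<le> W x" "\<And>x. x \<notin> A \<Longrightarrow> W x = 0"
    and A: "A \<in> sets borel" "emeasure lborel A < \<infinity>"
    and V: "\<And>\<psi> \<psi>'. C1_deriv \<psi> \<psi>' \<Longrightarrow> (\<And>x. norm (\<psi> x) \<le> 1) \<Longrightarrow> (\<integral>x. W x * divergence \<psi> x \<partial>lborel) \<le> V"
    and r: "0 < r"
  shows "measure lborel (ball (0::'a) r) * (\<integral>x. W x \<partial>lborel) \<le>
    measure lborel A * (\<integral>x. W x \<partial>lborel) + measure lborel (ball (0::'a) r) * (r * V)"
proof -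
  define b where "b = measure lborel (ball (0::'a) r)"
  define I where "I = (\<integral>x. W x \<partial>lborel)"
  have b0: "0 \<le> b" by (simp add: b_def)
  have iA: "integrable lborel (indicat_real A)" using A by (intro integrable_real_indicator) auto
  have iB: "integrable lborel (indicat_real (ball (0::'a) r))"
    using emeasure_lborel_ball_finite by (intro integrable_real_indicator) auto
  have V0: "0 \<le> V"
    using V[OF C1_deriv_const[of 0]] by (simp add: divergence_const)
  have [measurable]: "W \<in> borel_measurable borel" using W(1) by auto
  have main: "b * (I - (\<integral>x. \<bar>conv (mollifier e) W x - W x\<bar> \<partial>lborel) - r * V) \<le> measure lborel A * I"
    if e: "0 < e" for e
  proof -
    define \<rho> where "\<rho> = (mollifier e :: 'a \<Rightarrow> real)"
    obtain L where L: "C11_deriv \<rho> (mollifier_deriv e) L" using C11_mollifier[OF e] unfolding \<rho>_def .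
    have \<rho>m: "\<rho> \<in> borel_measurable borel" using integrable_mollifier[OF e] by (auto simp: \<rho>_def)
    have \<rho>b: "\<bar>\<rho> x\<bar> \<le> L" for x using L by (auto simp: C11_deriv_def)
    define s where "s = conv \<rho> (indicat_real A)"
    obtain s' Ls where s: "C11_deriv s s' Ls" using C11_deriv_conv[OF L iA] unfolding s_def by blast
    have ints: "integrable lborel s" unfolding s_def \<rho>_def by (rule conv_L1(1)[OF integrable_mollifier[OF e] iA])
    have s1: "\<bar>s x\<bar> \<le> 1" for x
      unfolding s_def \<rho>_def using norm_mollify_le[OF e iA, of 1 x] by simp
    have sA: "(\<integral>x. \<bar>s x\<bar> \<partial>lborel) \<le> measure lborel A"
    proof -
      have "(\<integral>x. \<bar>\<rho> x\<bar> \<partial>lborel) = 1"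
        using integral_mollifier[OF e, where 'a = 'a] by (simp add: \<rho>_def mollifier_nonneg[OF e])
      then show ?thesis
        using conv_L1(2)[OF integrable_mollifier[OF e] iA] A by (simp add: s_def \<rho>_def)
    qed
    \<comment> \<open>\<open>\<Phi> z\<close> is the mass of \<open>W\<close> in the translate of
      \<open>A\<close> by \<open>z\<close>, with the indicator of \<open>A\<close> smoothed so that
      the mass is differentiable in \<open>z\<close>.\<close>
    define \<Phi> where "\<Phi> = conv (\<lambda>x. s (- x)) W"
    note sm = C11_deriv_reflect[OF s]
    note d\<Phi> = C11_deriv_conv[OF sm W(1), folded \<Phi>_def]
    have \<Phi>_eq: "\<Phi> z = (\<integral>y. s (y - z) * W y \<partial>lborel)" for z unfolding \<Phi>_def conv_def by simp
    have grad: "(\<integral>y. s' (y - z) u * W y \<partial>lborel) \<le> V * norm u" for z u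
    proof (cases "u = 0")
      case True
      have "s' x 0 = 0" for x
        using C1_deriv_linear[OF C11_imp_C1_deriv[OF s], of x] bounded_linear.linear linear_0 by blast
      then show ?thesis using True by simp
    next
      case False
      \<comment> \<open>The field \<open>s (x - z) *\<^sub>R v\<close> has norm at most one, and its
        divergence is the derivative of the shifted \<open>s\<close> in direction \<open>v\<close>;
        hence \<open>V\<close> bounds the gradient of \<Phi>.\<close>
      define v where "v = u /\<^sub>R norm u"
      have nv: "norm v = 1" using False by (simp add: v_def)
      note sh = C1_deriv_shift[OF C11_imp_C1_deriv[OF s], of z]
      have lin: "linear (s' x)" for x
        using C1_deriv_linear[OF C11_imp_C1_deriv[OF s], of x] bounded_linear.linear by blast
      have div: "divergence (\<lambda>x. s (x - z) *\<^sub>R v) x = s' (x - z) u / norm u" for x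
        unfolding divergence_scaleR[OF sh C1_deriv_const] divergence_const
        by (simp add: v_def linear_scale[OF lin] divide_inverse mult.commute)
      have "(\<integral>x. W x * divergence (\<lambda>x. s (x - z) *\<^sub>R v) x \<partial>lborel) \<le> V"
        by (rule V[OF C1_deriv_scaleR[OF sh C1_deriv_const]]) (use s1 nv in simp)
      moreover have "(\<integral>x. W x * divergence (\<lambda>x. s (x - z) *\<^sub>R v) x \<partial>lborel) = (\<integral>y. s' (y - z) u * W y \<partial>lborel) / norm u"
        unfolding div by (simp add: mult.commute)
      ultimately show ?thesis using False by (simp add: divide_le_eq)
    qed
    \<comment> \<open>Since \<open>W\<close> vanishes off \<open>A\<close>, nearly all of its mass
      is counted at \<open>z = 0\<close>; only the L^1 error of mollification is lost.\<close>
    have lower: "I - (\<integral>x. \<bar>conv (mollifier e) W x - W x\<bar> \<partial>lborel) \<le> \<Phi> 0"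
    proof -
      have iWe: "integrable lborel (conv \<rho> W)" unfolding \<rho>_def by (rule conv_L1(1)[OF integrable_mollifier[OF e] W(1)])
      have "\<Phi> 0 = (\<integral>y. W y * conv (\<lambda>z. \<rho> (- z)) (indicat_real A) y \<partial>lborel)"
        unfolding \<Phi>_eq s_def \<rho>_def mollifier_minus by (simp add: mult.commute)
      also have "\<dots> = (\<integral>x. conv \<rho> W x * indicat_real A x \<partial>lborel)"
        by (rule conv_duality(2)[OF \<rho>m \<rho>b W(1) iA, symmetric])
      finally have \<Phi>0: "\<Phi> 0 = (\<integral>x. conv \<rho> W x * indicat_real A x \<partial>lborel)" .
      have i: "integrable lborel (\<lambda>x. conv \<rho> W x * indicat_real A x)"
        by (rule conv_duality(1)[OF \<rho>m \<rho>b W(1) iA])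
      have "I - \<Phi> 0 = (\<integral>x. W x - conv \<rho> W x * indicat_real A x \<partial>lborel)"
        unfolding I_def \<Phi>0 using i W(1) by simp
      also have "\<dots> \<le> (\<integral>x. \<bar>conv \<rho> W x - W x\<bar> \<partial>lborel)"
      proof (rule integral_mono)
        show "W x - conv \<rho> W x * indicat_real A x \<le> \<bar>conv \<rho> W x - W x\<bar>" for x
          using W(3)[of x] by (cases "x \<in> A") auto
      qed (use i W(1) iWe in auto)
      finally show ?thesis by (simp add: \<rho>_def)
    qed
    have osc: "\<Phi> 0 \<le> \<Phi> z + r * V" if z: "z \<in> ball 0 r" for z
    proof -
      have "norm (\<Phi> 0 - \<Phi> z) \<le> V * norm (0 - z)"
      proof (rule differentiable_bound[of UNIV])
        fix x :: 'a
        show "(\<Phi> has_derivative (\<lambda>h. \<integral>y. - s' (- (x - y)) h *\<^sub>R W y \<partial>lborel)) (at x within UNIV)"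
          using d\<Phi> by (auto simp: C11_deriv_def)
        show "onorm (\<lambda>h. \<integral>y. - s' (- (x - y)) h *\<^sub>R W y \<partial>lborel) \<le> V"
        proof (rule onorm_le)
          fix h :: 'a
          have lin: "linear (s' y)" for y
            using C1_deriv_linear[OF C11_imp_C1_deriv[OF s], of y] bounded_linear.linear by blast
          have "\<bar>\<integral>y. s' (y - x) h * W y \<partial>lborel\<bar> \<le> V * norm h"
            using grad[of x h] grad[of x "- h"] by (simp add: linear_neg[OF lin])
          then show "norm (\<integral>y. - s' (- (x - y)) h *\<^sub>R W y \<partial>lborel) \<le> V * norm h" by simp
        qed
      qed auto
      also have "\<dots> \<le> V * r" using z V0 by (intro mult_left_mono) auto
      finally show ?thesis by (simp add: mult.commute abs_le_iff)
    qed
    have smm: "(\<lambda>x. s (- x)) \<in> borel_measurable borel"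
      by (rule borel_measurable_C1(1)[OF C11_imp_C1_deriv[OF sm]])
    have smb: "\<bar>s (- x)\<bar> \<le> 1" for x by (rule s1)
    note dual = conv_duality[OF smm smb W(1) iB, folded \<Phi>_def]
    \<comment> \<open>Integration over the ball of translations: below, \<Phi> loses at most
      \<open>r * V\<close> from its value at 0; above, Fubini shows that each point \<open>y\<close>
      lies in the translates of \<open>A\<close> for a set of translations of volume at most that of
      \<open>A\<close>, up to smoothing.\<close>
    have "b * (I - (\<integral>x. \<bar>conv (mollifier e) W x - W x\<bar> \<partial>lborel) - r * V) =
        (\<integral>z. (I - (\<integral>x. \<bar>conv (mollifier e) W x - W x\<bar> \<partial>lborel) - r * V) * indicat_real (ball (0::'a) r) z \<partial>lborel)"
      by (simp add: b_def mult.commute)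
    also have "\<dots> \<le> (\<integral>z. \<Phi> z * indicat_real (ball (0::'a) r) z \<partial>lborel)"
    proof (rule integral_mono)
      fix z
      show "(I - (\<integral>x. \<bar>conv (mollifier e) W x - W x\<bar> \<partial>lborel) - r * V) * indicat_real (ball (0::'a) r) z
          \<le> \<Phi> z * indicat_real (ball (0::'a) r) z"
        using osc[of z] lower by (cases "z \<in> ball 0 r") auto
    qed (use iB dual(1) in auto)
    also have "\<dots> = (\<integral>y. W y * conv s (indicat_real (ball 0 r)) y \<partial>lborel)" using dual(2) by simp
    also have "\<dots> \<le> (\<integral>y. W y * measure lborel A \<partial>lborel)"
    proof (rule integral_mono)
      have sme: "s \<in> borel_measurable borel" using ints by auto
      show "integrable lborel (\<lambda>y. W y * conv s (indicat_real (ball 0 r)) y)"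
        using conv_duality(1)[OF sme s1 iB W(1)] by (simp add: mult.commute)
      show "integrable lborel (\<lambda>y. W y * measure lborel A)" using W(1) by simp
      fix y
      have "conv s (indicat_real (ball 0 r)) y \<le> (\<integral>x. \<bar>s (y - x)\<bar> \<partial>lborel)"
        unfolding conv_def
      proof (rule integral_mono)
        show "integrable lborel (\<lambda>x. \<bar>s (y - x)\<bar>)"
          using integrable_lborel_reflect[OF ints, of y] by auto
        show "integrable lborel (\<lambda>x. s (y - x) *\<^sub>R indicat_real (ball 0 r) x)"
          by (rule integrable_bounded_scaleR[OF iB]) (use s1 sme in auto)
      qed (auto simp: indicator_def)
      also have "\<dots> = (\<integral>x. \<bar>s x\<bar> \<partial>lborel)"
        using integral_lborel_reflect[of "\<lambda>x. \<bar>s x\<bar>" y] sme by simp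
      also note sA
      finally show "W y * conv s (indicat_real (ball 0 r)) y \<le> W y * measure lborel A"
        using W(2)[of y] by (intro mult_left_mono)
    qed
    also have "\<dots> = measure lborel A * I" by (simp add: I_def mult.commute)
    finally show ?thesis .
  qed
  have "((\<lambda>e. b * (I - (\<integral>x. \<bar>conv (mollifier e) W x - W x\<bar> \<partial>lborel) - r * V)) \<longlongrightarrow> b * (I - 0 - r * V)) (at_right 0)"
    by (intro tendsto_intros mollify_tendsto_L1 W(1))
  moreover have "\<forall>\<^sub>F e in at_right 0. b * (I - (\<integral>x. \<bar>conv (mollifier e) W x - W x\<bar> \<partial>lborel) - r * V) \<le> measure lborel A * I"
    using main eventually_at_right_less[of "0::real"] by (auto elim: eventually_mono)
  ultimately have "b * (I - 0 - r * V) \<le> measure lborel A * I"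
    by (intro tendsto_upperbound) auto
  then show ?thesis unfolding b_def[symmetric] I_def[symmetric] by (simp add: algebra_simps)
qed

section \<open>De Giorgi iteration\<close>

text \<open>\<open>R ^ 4\<close> is the maximum of the bump, attained at the centre, and
  \<open>4 / R\<close> is its gradient bound \<open>4 * R ^ 3\<close> after this
  normalization.\<close>

lemma cutoff_ball:
  fixes x0 :: "'a::euclidean_space"
  assumes R: "0 < R"
  shows "cutoff (\<lambda>x. bump R (x - x0) / R ^ 4) (\<lambda>x h. bump_deriv R (x - x0) h / R ^ 4) (cball x0 R) (4 / R)"
proof
  show "C1_deriv (\<lambda>x. bump R (x - x0) / R ^ 4) (\<lambda>x h. bump_deriv R (x - x0) h / R ^ 4)"
    by (rule C1_deriv_shift[OF C11_imp_C1_deriv[OF C11_deriv_scale[OF C11_bump[OF less_imp_le[OF R]]]]])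
  fix x h :: 'a
  show "0 \<le> bump R (x - x0) / R ^ 4" using R by (simp add: bump_nonneg)
  show "bump R (x - x0) / R ^ 4 \<le> 1" using R bump_le[of R "x - x0"] by simp
  show "bump R (x - x0) / R ^ 4 = 0" if "x \<notin> cball x0 R"
    using that R bump_zero(1)[of R "x - x0"] by (simp add: dist_norm norm_minus_commute)
  have "\<bar>bump_deriv R (x - x0) h / R ^ 4\<bar> \<le> 4 * R ^ 3 * norm h / R ^ 4"
    using R bump_deriv_le[of R "x - x0" h] by (simp add: abs_divide divide_right_mono)
  also have "\<dots> = 4 / R * norm h" using R by (simp add: field_simps power3_eq_cube power4_eq_xxxx)
  finally show "\<bar>bump_deriv R (x - x0) h / R ^ 4\<bar> \<le> 4 / R * norm h" .
qed simp

text \<open>This cut-off is not constant on the smaller ball; the lower bound, from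
  \<open>R\<^sup>2 - r\<^sup>2 \<ge> (R - r) * R\<close>, takes the place of the usual value 1 at
  the price of a factor \<open>((R - r) / R)\<^sup>2\<close>.\<close>

lemma bump_lower:
  fixes x :: "'a::euclidean_space"
  assumes "0 < r" "r < R" "norm x \<le> r"
  shows "((R - r) / R)\<^sup>2 \<le> bump R x / R ^ 4"
proof -
  have "(R - r) * R \<le> (R - r) * (R + r)" using assms by (intro mult_left_mono) auto
  also have "\<dots> = R\<^sup>2 - r\<^sup>2" by (simp add: power2_eq_square algebra_simps)
  also have "\<dots> \<le> R\<^sup>2 - x \<bullet> x" using assms by (simp add: dot_square_norm power_mono)
  also have "\<dots> \<le> max 0 (R\<^sup>2 - x \<bullet> x)" by simp
  finally have "((R - r) * R)\<^sup>2 \<le> bump R x" unfolding bump_def using assms by (intro power_mono) auto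
  then have "((R - r) * R)\<^sup>2 / R ^ 4 \<le> bump R x / R ^ 4" using assms by (intro divide_right_mono) auto
  moreover have "((R - r) * R)\<^sup>2 / R ^ 4 = ((R - r) / R)\<^sup>2"
    using assms by (simp add: power_divide power_mult_distrib field_simps power4_eq_xxxx power2_eq_square)
  ultimately show ?thesis by simp
qed

context minimizer
begin

definition excess :: "'a \<Rightarrow> real \<Rightarrow> real \<Rightarrow> real" where
  "excess x0 \<rho> k = (\<integral>x. indicat_real (cball x0 \<rho>) x * max 0 (U x - k) \<partial>lborel)"

lemma borel_measurable_U [measurable]: "U \<in> borel_measurable borel"
  using integrable by auto

lemma integrable_excess:
  assumes "0 \<le> k"
  shows "integrable lborel (\<lambda>x. indicat_real (cball x0 \<rho>) x * max 0 (U x - k))"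
  by (rule Bochner_Integration.integrable_bound[OF integrable]) (use assms in \<open>auto simp: indicator_def\<close>)

lemma excess_nonneg: "0 \<le> excess x0 \<rho> k"
  unfolding excess_def by (intro integral_nonneg_AE) (auto simp: indicator_def)

lemma excess_mono:
  assumes "r \<le> R" "0 \<le> k" "k \<le> l"
  shows "excess x0 r l \<le> excess x0 R k"
  unfolding excess_def
  using assms by (intro integral_mono integrable_excess) (auto simp: indicator_def)

text \<open>Chebyshev bounds the volume of \<open>{U > l}\<close> in the larger ball by the excess
  over \<open>k\<close> divided by \<open>l - k\<close>. A ball of radius \<open>s\<close> with at
  least twice that volume lets the isoperimetric estimate absorb half the mass, leaving
  \<open>2 * s\<close> times the variation bound of the energy estimate. The radius stays free so
  that the iteration can shrink it together with the excess.\<close>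

lemma excess_step:
  assumes R: "cball x0 R \<subseteq> \<Omega>" "0 < r" "r < R" and k: "0 \<le> k" "k < l"
    and s: "0 < s" "2 * excess x0 R k / (l - k) \<le> measure lborel (ball (0::'a) s)"
  shows "excess x0 r l * ((R - r) / R)\<^sup>2 \<le> 2 * s * (8 / R * excess x0 R k)"
proof -
  have R0: "0 < R" and l0: "0 \<le> l" using R k by auto
  define \<eta> where "\<eta> x = bump R (x - x0) / R ^ 4" for x
  note cut = cutoff_ball[OF R0, of x0, folded \<eta>_def]
  interpret cutoff \<eta> "\<lambda>x h. bump_deriv R (x - x0) h / R ^ 4" "cball x0 R" "4 / R" by (rule cut)
  have [measurable]: "\<eta> \<in> borel_measurable borel" by (rule borel_measurable_C1(1)[OF C1])
  define W where "W x = \<eta> x * max 0 (U x - l)" for x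
  define A where "A = {x \<in> cball x0 R. l < U x}"
  \<comment> \<open>The energy estimate doubles the gradient bound \<open>4 / R\<close> of the
    cut-off.\<close>
  define V where "V = 8 / R * excess x0 R k"
  define b where "b = measure lborel (ball (0::'a) s)"
  define I where "I = (\<integral>x. W x \<partial>lborel)"
  have Ab: "A \<in> sets borel"
  proof -
    have "A = cball x0 R \<inter> {x \<in> space borel. l < U x}" by (auto simp: A_def)
    also have "\<dots> \<in> sets borel" by measurable
    finally show ?thesis .
  qed
  have Afin: "emeasure lborel A < \<infinity>"
  proof -
    have "emeasure lborel A \<le> emeasure lborel (cball x0 R)" by (rule emeasure_mono) (auto simp: A_def)
    then show ?thesis using emeasure_lborel_cball_finite[of x0 R] by (rule le_less_trans)
  qed
  have iA: "integrable lborel (indicat_real A)" using Ab Afin by (intro integrable_real_indicator) auto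
  have iW: "integrable lborel W"
  proof (rule Bochner_Integration.integrable_bound[OF integrable])
    have "\<bar>\<eta> x\<bar> * \<bar>max 0 (U x - l)\<bar> \<le> 1 * \<bar>U x\<bar>" for x
      using bounds[of x] l0 by (intro mult_mono) auto
    then show "AE x in lborel. norm (W x) \<le> norm (U x)" by (simp add: W_def abs_mult)
  qed (simp add: W_def[abs_def])
  have W0: "0 \<le> W x" for x using bounds[of x] by (simp add: W_def)
  have WA: "W x = 0" if "x \<notin> A" for x
    using that zero_outside[of x] by (auto simp: W_def A_def)
  have WV: "(\<integral>x. W x * divergence \<psi> x \<partial>lborel) \<le> V" if \<psi>: "C1_deriv \<psi> \<psi>'" "\<And>x. norm (\<psi> x) \<le> 1" for \<psi> \<psi>'
  proof -
    have "(\<integral>x. W x * divergence \<psi> x \<partial>lborel) \<le> 2 * (4 / R) * excess x0 R l"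
      unfolding W_def excess_def by (rule energy_estimate[OF cut R(1) l0 \<psi>])
    also have "\<dots> \<le> 2 * (4 / R) * excess x0 R k"
      using R0 k by (intro mult_left_mono excess_mono) auto
    finally show ?thesis by (simp add: V_def)
  qed
  \<comment> \<open>On \<open>A\<close> the function exceeds \<open>k\<close> by more than
    \<open>l - k\<close>.\<close>
  have Ak: "measure lborel A * (l - k) \<le> excess x0 R k"
  proof -
    have "measure lborel A * (l - k) = (\<integral>x. indicat_real A x * (l - k) \<partial>lborel)" using Ab by simp
    also have "\<dots> \<le> excess x0 R k"
      unfolding excess_def
    proof (rule integral_mono)
      show "indicat_real A x * (l - k) \<le> indicat_real (cball x0 R) x * max 0 (U x - k)" for x
        using k by (auto simp: A_def indicator_def)
    qed (use iA integrable_excess[OF k(1)] in auto)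
    finally show ?thesis .
  qed
  have b0: "0 < b" unfolding b_def using s(1) content_ball_pos[of s "0::'a"] by simp
  have "2 * measure lborel A \<le> 2 * excess x0 R k / (l - k)" using Ak k by (simp add: field_simps)
  then have Ab2: "2 * measure lborel A \<le> b" using s(2) by (simp add: b_def)
  have I0: "0 \<le> I" unfolding I_def by (intro integral_nonneg_AE) (simp add: W0)
  have "b * I \<le> measure lborel A * I + b * (s * V)"
    unfolding b_def I_def by (rule isoperimetric_estimate[OF iW W0 WA Ab Afin WV s(1)])
  also have "\<dots> \<le> b / 2 * I + b * (s * V)"
    using Ab2 I0 by (intro add_right_mono mult_right_mono) auto
  finally have "b * (I / 2) \<le> b * (s * V)" by (simp add: field_simps)
  then have IV: "I \<le> 2 * s * V" using b0 by simp
  have "excess x0 r l * ((R - r) / R)\<^sup>2 = (\<integral>x. indicat_real (cball x0 r) x * max 0 (U x - l) * ((R - r) / R)\<^sup>2 \<partial>lborel)"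
    unfolding excess_def by simp
  also have "\<dots> \<le> I"
    unfolding I_def
  proof (rule integral_mono)
    fix x
    show "indicat_real (cball x0 r) x * max 0 (U x - l) * ((R - r) / R)\<^sup>2 \<le> W x"
    proof (cases "x \<in> cball x0 r")
      case True
      then have "((R - r) / R)\<^sup>2 \<le> \<eta> x"
        unfolding \<eta>_def using R by (intro bump_lower) (auto simp: dist_norm norm_minus_commute)
      then have "max 0 (U x - l) * ((R - r) / R)\<^sup>2 \<le> max 0 (U x - l) * \<eta> x" by (intro mult_left_mono) auto
      then show ?thesis using True by (simp add: W_def mult.commute)
    qed (simp add: W0)
  qed (use integrable_excess[OF l0] iW in auto)
  finally show ?thesis using IV by (simp add: V_def)
qed

text \<open>De Giorgi iteration: the radii shrink from \<open>R\<close> to \<open>R / 2\<close> and the levels rise from \<open>0\<close> to \<open>T\<close>, both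
  dyadically; the radius of the averaging ball in the \<open>n\<close>th step is proportional to \<open>4\<^sup>-\<^sup>n\<close>.\<close>

lemma excess_decay:
  fixes x0 :: 'a and R T :: real
  defines "N \<equiv> DIM('a)" and "a \<equiv> excess x0 R 0" and "q \<equiv> (1 / 2) ^ (2 * DIM('a)) / 2 :: real"
  assumes R: "cball x0 R \<subseteq> \<Omega>" "0 < R" and T: "0 < T" "4 * a / T \<le> unit_ball_vol N * (q * R / 512) ^ N"
  shows "excess x0 (R / 2 * (1 + (1 / 2) ^ n)) (T * (1 - (1 / 2) ^ n)) \<le> a * ((1 / 2) ^ n) ^ (2 * N) * (1 / 2) ^ n"
proof (induction n)
  case 0
  then show ?case by (simp add: a_def)
next
  case (Suc n)
  define p :: real where "p = (1 / 2) ^ n"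
  have p: "0 < p" "p \<le> 1" by (auto simp: p_def power_le_one)
  have q0: "0 < q" by (simp add: q_def)
  define R1 where "R1 = R / 2 * (1 + p)"
  define R2 where "R2 = R / 2 * (1 + p / 2)"
  define k where "k = T * (1 - p)"
  define l where "l = T * (1 - p / 2)"
  \<comment> \<open>Chosen so that \<open>2 * s * (16 / R)\<close> equals
    \<open>q * (p / 4)\<^sup>2\<close>: the factor \<open>(p / 4)\<^sup>2\<close> cancels the loss
    of the cut-off, and \<open>q\<close> is exactly the ratio of the claimed bounds at consecutive
    steps.\<close>
  define s where "s = q * R / 512 * p\<^sup>2"
  have R1: "0 < R2" "R2 < R1" "R1 \<le> R" "R1 - R2 = R * p / 4" "R / 2 \<le> R1"
  proof -
    show "0 < R2" using R(2) p by (simp add: R2_def add_pos_pos)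
  qed (use R(2) p in \<open>auto simp: R1_def R2_def field_simps\<close>)
  have k: "0 \<le> k" "k < l" "l - k = T * p / 2" using T(1) p by (auto simp: k_def l_def field_simps)
  have s: "0 < s" using q0 R(2) p by (simp add: s_def)
  have IH: "excess x0 R1 k \<le> a * p ^ (2 * N) * p" using Suc.IH by (simp add: p_def R1_def k_def)
  \<comment> \<open>This fixes the exponent in the claim: one factor \<open>p\<close> is used up by
    \<open>l - k = T * p / 2\<close>, and \<open>p ^ (2 * N)\<close> matches the volume of a ball
    whose radius scales like \<open>p\<^sup>2\<close>. What remains is the assumption on
    \<open>T\<close>.\<close>
  have big: "2 * excess x0 R1 k / (l - k) \<le> measure lborel (ball (0::'a) s)"
  proof -
    have "2 * excess x0 R1 k / (l - k) \<le> 2 * (a * p ^ (2 * N) * p) / (l - k)"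
      using IH k by (intro divide_right_mono mult_left_mono) auto
    also have "\<dots> = (4 * a / T) * p ^ (2 * N)" using p T(1) by (simp add: k(3) field_simps)
    also have "\<dots> \<le> (unit_ball_vol N * (q * R / 512) ^ N) * p ^ (2 * N)"
      using T(2) p by (intro mult_right_mono) auto
    also have "\<dots> = unit_ball_vol N * s ^ N"
      by (simp add: s_def power_mult_distrib power_mult power_divide)
    also have "\<dots> = measure lborel (ball (0::'a) s)"
      using s content_ball[of s "0::'a"] by (simp add: N_def)
    finally show ?thesis .
  qed
  have "cball x0 R1 \<subseteq> \<Omega>" using R(1) R1(3) subset_cball by blast
  from excess_step[OF this R1(1,2) k(1,2) s big]
  have step: "excess x0 R2 l * ((R1 - R2) / R1)\<^sup>2 \<le> 2 * s * (8 / R1 * excess x0 R1 k)" .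
  have "p / 4 \<le> (R1 - R2) / R1"
    using R1 R(2) p by (simp add: le_divide_eq mult.commute)
  then have "(p / 4)\<^sup>2 \<le> ((R1 - R2) / R1)\<^sup>2" using p by (intro power_mono) auto
  then have "excess x0 R2 l * (p / 4)\<^sup>2 \<le> excess x0 R2 l * ((R1 - R2) / R1)\<^sup>2"
    by (intro mult_left_mono excess_nonneg)
  also note step
  also have "2 * s * (8 / R1 * excess x0 R1 k) \<le> 2 * s * (16 / R * excess x0 R1 k)"
    using s R1(5) R(2) by (intro mult_left_mono mult_right_mono excess_nonneg) (auto simp: field_simps)
  also have "\<dots> = (q * excess x0 R1 k) * (p / 4)\<^sup>2"
    using R(2) by (simp add: s_def power2_eq_square)
  finally have "excess x0 R2 l * (p / 4)\<^sup>2 \<le> (q * excess x0 R1 k) * (p / 4)\<^sup>2" .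
  then have "excess x0 R2 l \<le> q * excess x0 R1 k" using p by (simp add: mult_le_cancel_right)
  also have "\<dots> \<le> q * (a * p ^ (2 * N) * p)" using IH q0 by (intro mult_left_mono) auto
  also have "\<dots> = a * (p / 2) ^ (2 * N) * (p / 2)" by (simp add: q_def N_def power_divide)
  finally show ?case by (simp add: R2_def l_def p_def)
qed

text \<open>For \<open>T\<close> large the excess over \<open>T\<close> on the ball of radius
  \<open>R / 2\<close> lies below every term of a geometric sequence, hence is zero.\<close>

proposition locally_bounded_above:
  assumes R: "cball x0 R \<subseteq> \<Omega>" "0 < R"
  shows "\<exists>T. AE x in lborel. x \<in> cball x0 (R / 2) \<longrightarrow> U x \<le> T"
proof -
  define a where "a = excess x0 R 0"
  define N where "N = DIM('a)"
  define B where "B = unit_ball_vol N * (((1 / 2) ^ (2 * N) / 2) * R / 512) ^ N"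
  have a0: "0 \<le> a" unfolding a_def by (rule excess_nonneg)
  have B: "0 < B" using R(2) by (simp add: B_def)
  \<comment> \<open>\<open>B\<close> is the threshold of \<open>excess_decay\<close>; the summand 1
    keeps \<open>T\<close> positive even if \<open>a = 0\<close>.\<close>
  define T where "T = 4 * a / B + 1"
  have T: "0 < T" using a0 B by (simp add: T_def add_nonneg_pos)
  have "4 * a \<le> B * T" using B by (simp add: T_def field_simps)
  then have TB: "4 * a / T \<le> B" using T by (simp add: field_simps)
  have le: "excess x0 (R / 2) T \<le> a * (1 / 2) ^ n" for n
  proof -
    have p: "0 \<le> (1 / 2 :: real) ^ n" "(1 / 2 :: real) ^ n \<le> 1" by (auto simp: power_le_one)
    have "excess x0 (R / 2) T \<le> excess x0 (R / 2 * (1 + (1 / 2) ^ n)) (T * (1 - (1 / 2) ^ n))"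
      using R(2) T p by (intro excess_mono) (auto simp: algebra_simps)
    also have "\<dots> \<le> a * ((1 / 2) ^ n) ^ (2 * N) * (1 / 2) ^ n"
      unfolding a_def N_def by (rule excess_decay[OF R T]) (use TB in \<open>simp add: a_def B_def N_def\<close>)
    also have "\<dots> \<le> a * 1 * (1 / 2) ^ n"
      using p a0 by (intro mult_right_mono mult_left_mono power_le_one) auto
    finally show ?thesis by simp
  qed
  have "(\<lambda>n. a * (1 / 2) ^ n) \<longlonglongrightarrow> a * 0"
    by (intro tendsto_intros LIMSEQ_power_zero) simp
  then have "excess x0 (R / 2) T \<le> a * 0"
    by (rule tendsto_lowerbound) (use le in \<open>auto intro: always_eventually\<close>)
  then have "excess x0 (R / 2) T = 0" using excess_nonneg[of x0 "R / 2" T] by simp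
  then have "AE x in lborel. indicat_real (cball x0 (R / 2)) x * max 0 (U x - T) = 0"
    unfolding excess_def
    using integral_nonneg_eq_0_iff_AE[OF integrable_excess[OF less_imp_le[OF T], of x0 "R / 2"]] by simp
  then have "AE x in lborel. x \<in> cball x0 (R / 2) \<longrightarrow> U x \<le> T"
    by eventually_elim (auto simp: indicator_def max_def split: if_splits)
  then show ?thesis by blast
qed

end

lemma borel_measurable_divergence:
  assumes "\<zeta> \<in> C1_compact_fields \<Omega>"
  shows "divergence \<zeta> \<in> borel_measurable borel"
proof -
  obtain \<zeta>' where "C1_deriv \<zeta> \<zeta>'" using C1_compact_fieldsE[OF assms] by metis
  then show ?thesis by (intro borel_measurable_continuous_onI continuous_divergence)
qed

context minimizer
begin

text \<open>Admissible test fields are closed under negation, so a function and its negative have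
  the same variation; the bound from above then yields the bound from below.\<close>

lemma minimizer_minus: "minimizer \<Omega> (\<lambda>x. - U x) M"
proof
  show "open \<Omega>" by (rule open_domain)
  show "Bochner_Integration.integrable lborel (\<lambda>x. - U x)" using integrable by simp
  show "(\<integral>x. - U x * divergence \<zeta> x \<partial>lborel) \<le> M"
    if "\<zeta> \<in> C1_compact_fields \<Omega>" "\<And>x. norm (\<zeta> x) \<le> 1" for \<zeta>
    using variation_le[OF C1_compact_fields_minus(1)[OF that(1)]] that(2)
    by (simp add: C1_compact_fields_minus(2)[OF that(1)])
  fix W :: "'a \<Rightarrow> real" and K C S
  assume W: "Bochner_Integration.integrable lborel W" and K: "compact K" "K \<subseteq> \<Omega>" "\<And>x. x \<notin> K \<Longrightarrow> W x = 0"
    and C: "\<And>\<zeta>. \<zeta> \<in> C1_compact_fields \<Omega> \<Longrightarrow> (\<And>x. norm (\<zeta> x) \<le> 1) \<Longrightarrow> (\<integral>x. W x * divergence \<zeta> x \<partial>lborel) \<le> C"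
    and S: "\<And>\<zeta>. \<zeta> \<in> C1_compact_fields \<Omega> \<Longrightarrow> (\<And>x. norm (\<zeta> x) \<le> 1) \<Longrightarrow> (\<integral>x. (- U x + W x) * divergence \<zeta> x \<partial>lborel) \<le> S"
  show "M \<le> S"
  proof (rule minimal[of "\<lambda>x. - W x" K])
    fix \<zeta> assume \<zeta>: "\<zeta> \<in> C1_compact_fields \<Omega>" "\<And>x. norm (\<zeta> x) \<le> 1"
    show "(\<integral>x. - W x * divergence \<zeta> x \<partial>lborel) \<le> C"
      using C[OF C1_compact_fields_minus(1)[OF \<zeta>(1)]] \<zeta>(2)
      by (simp add: C1_compact_fields_minus(2)[OF \<zeta>(1)])
    have "(\<integral>x. (- U x + W x) * divergence (\<lambda>x. - \<zeta> x) x \<partial>lborel) \<le> S"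
      using \<zeta> by (intro S C1_compact_fields_minus(1)) auto
    moreover have "(- U x + W x) * divergence (\<lambda>x. - \<zeta> x) x = (U x + - W x) * divergence \<zeta> x" for x
      unfolding C1_compact_fields_minus(2)[OF \<zeta>(1)] by (simp add: algebra_simps)
    ultimately show "(\<integral>x. (U x + - W x) * divergence \<zeta> x \<partial>lborel) \<le> S" by simp
  qed (use W K in auto)
qed

proposition locally_bounded:
  assumes "x \<in> \<Omega>"
  shows "\<exists>\<delta> T. 0 < \<delta> \<and> 0 \<le> T \<and> (AE y in lborel. y \<in> ball x \<delta> \<longrightarrow> \<bar>U y\<bar> \<le> T)"
proof -
  interpret neg: minimizer \<Omega> "\<lambda>x. - U x" M by (rule minimizer_minus)
  obtain R where R: "0 < R" "cball x R \<subseteq> \<Omega>"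
    using open_domain assms open_contains_cball by metis
  obtain T1 T2 where T: "AE y in lborel. y \<in> cball x (R / 2) \<longrightarrow> U y \<le> T1"
    "AE y in lborel. y \<in> cball x (R / 2) \<longrightarrow> - U y \<le> T2"
    using locally_bounded_above[OF R(2,1)] neg.locally_bounded_above[OF R(2,1)] by blast
  have "AE y in lborel. y \<in> ball x (R / 2) \<longrightarrow> \<bar>U y\<bar> \<le> \<bar>T1\<bar> + \<bar>T2\<bar>"
    using T by eventually_elim auto
  then show ?thesis using R(1) by (intro exI[of _ "R / 2"] exI[of _ "\<bar>T1\<bar> + \<bar>T2\<bar>"]) auto
qed

lemma bounded_on_compact:
  assumes "compact K" "K \<subseteq> \<Omega>"
  shows "\<exists>C. AE y in lborel. y \<in> K \<longrightarrow> \<bar>U y\<bar> \<le> C"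
proof -
  have "\<forall>x\<in>\<Omega>. \<exists>\<delta> T. 0 < \<delta> \<and> 0 \<le> T \<and> (AE y in lborel. y \<in> ball x \<delta> \<longrightarrow> \<bar>U y\<bar> \<le> T)"
    using locally_bounded by (rule ballI)
  from bchoice[OF this] obtain \<delta> where
    "\<forall>x\<in>\<Omega>. \<exists>T. 0 < \<delta> x \<and> 0 \<le> T \<and> (AE y in lborel. y \<in> ball x (\<delta> x) \<longrightarrow> \<bar>U y\<bar> \<le> T)" ..
  from bchoice[OF this] obtain T where *:
    "\<forall>x\<in>\<Omega>. 0 < \<delta> x \<and> 0 \<le> T x \<and> (AE y in lborel. y \<in> ball x (\<delta> x) \<longrightarrow> \<bar>U y\<bar> \<le> T x)" ..
  have \<delta>T: "0 < \<delta> x" "0 \<le> T x" "AE y in lborel. y \<in> ball x (\<delta> x) \<longrightarrow> \<bar>U y\<bar> \<le> T x" if "x \<in> \<Omega>" for x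
    using *[rule_format, OF that] by simp_all
  have "K \<subseteq> (\<Union>x\<in>K. ball x (\<delta> x))"
  proof
    fix x assume "x \<in> K"
    then show "x \<in> (\<Union>x\<in>K. ball x (\<delta> x))" using \<delta>T(1)[of x] assms(2) by (intro UN_I[of x]) auto
  qed
  then obtain F where F: "F \<subseteq> K" "finite F" "K \<subseteq> (\<Union>x\<in>F. ball x (\<delta> x))"
    by (rule compactE_image[OF assms(1), rotated]) auto
  have F\<Omega>: "x \<in> \<Omega>" if "x \<in> F" for x using that F(1) assms(2) by blast
  have "AE y in lborel. \<forall>x\<in>F. y \<in> ball x (\<delta> x) \<longrightarrow> \<bar>U y\<bar> \<le> T x"
    using F(2) \<delta>T(3)[OF F\<Omega>] by (intro AE_finite_allI) auto
  \<comment> \<open>The bounds are nonnegative, so their sum dominates each of them, and it makes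
    sense for an empty cover too.\<close>
  then have "AE y in lborel. y \<in> K \<longrightarrow> \<bar>U y\<bar> \<le> sum T F"
  proof eventually_elim
    case (elim y)
    show ?case
    proof
      assume "y \<in> K"
      then obtain x where x: "x \<in> F" "y \<in> ball x (\<delta> x)" using F(3) by blast
      then have "\<bar>U y\<bar> \<le> T x" using elim by blast
      also have "T x \<le> sum T F" using x(1) F(2) \<delta>T(2)[OF F\<Omega>] by (intro member_le_sum) auto
      finally show "\<bar>U y\<bar> \<le> sum T F" .
    qed
  qed
  then show ?thesis by blast
qed

end

section \<open>Borel representatives\<close>

text \<open>The analysis above uses Fubini and translations on \<open>lborel\<close> and thus Borel
  functions on the whole space, whereas members of \<open>BV \<Omega>\<close> are Lebesgue
  measurable on \<Omega>. Extending by zero and changing the values on a null set alters no integral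
  against a Borel factor.\<close>

lemma borel_representative:
  fixes v V :: "'a::euclidean_space \<Rightarrow> real"
  assumes \<Omega>: "\<Omega> \<in> sets borel" and v: "integrable (lebesgue_on \<Omega>) v"
    and V: "V \<in> borel_measurable borel" "AE x in lborel. indicat_real \<Omega> x * v x = V x"
  shows "integrable lborel V"
    and "D \<in> borel_measurable borel \<Longrightarrow>
      (\<integral>x. v x * D x \<partial>lebesgue_on \<Omega>) = (\<integral>x. V x * D x \<partial>lborel)"
proof -
  have \<Omega>': "\<Omega> \<inter> space lebesgue \<in> sets lebesgue" using \<Omega> by simp
  have iv: "integrable lebesgue (\<lambda>x. indicat_real \<Omega> x * v x)"
    using v integrable_restrict_space[OF \<Omega>', of v] by simp
  then have vm: "(\<lambda>x. indicat_real \<Omega> x * v x) \<in> borel_measurable lebesgue" by auto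
  have Vm: "V \<in> borel_measurable lebesgue" using V(1) by (auto intro: measurable_completion)
  have AE: "AE x in lebesgue. indicat_real \<Omega> x * v x = V x" using V(2) by (rule AE_completion)
  have "integrable lebesgue V"
    using integrable_cong_AE[OF vm Vm AE] iv by simp
  then show "integrable lborel V" using V(1) by (simp add: integrable_completion)
  assume D: "D \<in> borel_measurable borel"
  then have Dm: "D \<in> borel_measurable lebesgue" by (auto intro: measurable_completion)
  have "(\<integral>x. v x * D x \<partial>lebesgue_on \<Omega>) = (\<integral>x. (indicat_real \<Omega> x * v x) * D x \<partial>lebesgue)"
    using integral_restrict_space[OF \<Omega>', of "\<lambda>x. v x * D x"] by (simp add: mult.assoc)
  also have "\<dots> = (\<integral>x. V x * D x \<partial>lebesgue)"
  proof (rule integral_cong_AE)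
    show "AE x in lebesgue. (indicat_real \<Omega> x * v x) * D x = V x * D x"
      using AE by eventually_elim simp
  qed (use vm Vm Dm in auto)
  also have "\<dots> = (\<integral>x. V x * D x \<partial>lborel)" using V(1) D by (intro integral_completion) auto
  finally show "(\<integral>x. v x * D x \<partial>lebesgue_on \<Omega>) = (\<integral>x. V x * D x \<partial>lborel)" .
qed

lemma exists_borel_representative:
  fixes v :: "'a::euclidean_space \<Rightarrow> real"
  assumes \<Omega>: "\<Omega> \<in> sets borel" and v: "integrable (lebesgue_on \<Omega>) v"
  obtains V where "V \<in> borel_measurable borel" "AE x in lborel. indicat_real \<Omega> x * v x = V x"
proof -
  have "integrable lebesgue (\<lambda>x. indicat_real \<Omega> x * v x)"
    using v integrable_restrict_space[of \<Omega> lebesgue v] \<Omega> by simp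
  then show thesis
    using completion_ex_borel_measurable_real[of "\<lambda>x. indicat_real \<Omega> x * v x" lborel] that by auto
qed

text \<open>Translates the definitions over \<open>lebesgue_on \<Omega>\<close> into the setting of
  \<open>lborel\<close>; a bound for every admissible field is a bound for the supremum.\<close>

proposition least_gradient_minimizer:
  fixes u U :: "'a::euclidean_space \<Rightarrow> real"
  assumes \<Omega>: "open \<Omega>" and u: "least_gradient \<Omega> u"
    and U: "U \<in> borel_measurable borel" "AE x in lborel. indicat_real \<Omega> x * u x = U x"
  shows "\<exists>M. minimizer \<Omega> U M"
proof -
  have \<Omega>b: "\<Omega> \<in> sets borel" using \<Omega> by simp
  have BV: "u \<in> BV \<Omega>" and min: "\<And>v. v \<in> BV \<Omega> \<Longrightarrow> compactly_supported_in v \<Omega> \<Longrightarrow>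
      total_variation \<Omega> u \<le> total_variation \<Omega> (\<lambda>x. u x + v x)"
    using u by (auto simp: least_gradient_def)
  have iu: "integrable (lebesgue_on \<Omega>) u" and fin: "total_variation \<Omega> u < \<infinity>" using BV by (auto simp: BV_def)
  have upper: "ereal (\<integral>x. v x * divergence \<zeta> x \<partial>lebesgue_on \<Omega>) \<le> total_variation \<Omega> v"
    if "\<zeta> \<in> C1_compact_fields \<Omega>" "\<And>x. norm (\<zeta> x) \<le> 1" for v \<zeta>
    unfolding total_variation_def using that by (intro SUP_upper) auto
  \<comment> \<open>The zero field rules out the value minus infinity, so the variation is a real
    number \<open>M\<close>.\<close>
  have "0 \<le> total_variation \<Omega> u"
    using upper[OF C1_compact_fields_zero, of u] by (simp add: divergence_const zero_ereal_def)
  then obtain M where M: "total_variation \<Omega> u = ereal M" using fin by (cases "total_variation \<Omega> u") auto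
  have "minimizer \<Omega> U M"
  proof
    show "open \<Omega>" by fact
    show "integrable lborel U" by (rule borel_representative(1)[OF \<Omega>b iu U])
    show "(\<integral>x. U x * divergence \<zeta> x \<partial>lborel) \<le> M" if "\<zeta> \<in> C1_compact_fields \<Omega>" "\<And>x. norm (\<zeta> x) \<le> 1" for \<zeta>
      using upper[OF that, of u] borel_representative(2)[OF \<Omega>b iu U borel_measurable_divergence[OF that(1)]]
      unfolding M by simp
    fix W :: "'a \<Rightarrow> real" and K C S
    assume W: "integrable lborel W" and K: "compact K" "K \<subseteq> \<Omega>" "\<And>x. x \<notin> K \<Longrightarrow> W x = 0"
      and C: "\<And>\<zeta>. \<zeta> \<in> C1_compact_fields \<Omega> \<Longrightarrow> (\<And>x. norm (\<zeta> x) \<le> 1) \<Longrightarrow> (\<integral>x. W x * divergence \<zeta> x \<partial>lborel) \<le> C"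
      and S: "\<And>\<zeta>. \<zeta> \<in> C1_compact_fields \<Omega> \<Longrightarrow> (\<And>x. norm (\<zeta> x) \<le> 1) \<Longrightarrow> (\<integral>x. (U x + W x) * divergence \<zeta> x \<partial>lborel) \<le> S"
    have Wm: "W \<in> borel_measurable borel" using W by auto
    \<comment> \<open>A competitor vanishes off \<open>K\<close>, hence off \<Omega>, and is its own
      representative.\<close>
    have W\<Omega>: "indicat_real \<Omega> x * W x = W x" for x using K(2,3) by (auto simp: indicator_def)
    have iW: "integrable (lebesgue_on \<Omega>) W"
      using W Wm integrable_restrict_space[of \<Omega> lebesgue W] \<Omega>b by (simp add: W\<Omega> integrable_completion)
    have "total_variation \<Omega> W \<le> ereal C"
      unfolding total_variation_def
    proof (rule SUP_least)
      fix \<zeta> assume "\<zeta> \<in> {\<phi> \<in> C1_compact_fields \<Omega>. \<forall>x. norm (\<phi> x) \<le> 1}"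
      then have \<zeta>: "\<zeta> \<in> C1_compact_fields \<Omega>" "\<And>x. norm (\<zeta> x) \<le> 1" by auto
      show "ereal (\<integral>x. W x * divergence \<zeta> x \<partial>lebesgue_on \<Omega>) \<le> ereal C"
        using C[OF \<zeta>] borel_representative(2)[OF \<Omega>b iW Wm _ borel_measurable_divergence[OF \<zeta>(1)]] by (simp add: W\<Omega>)
    qed
    then have "W \<in> BV \<Omega>" using iW by (auto simp: BV_def intro: le_less_trans)
    moreover have "compactly_supported_in W \<Omega>" unfolding compactly_supported_in_def using K by auto
    ultimately have "ereal M \<le> total_variation \<Omega> (\<lambda>x. u x + W x)" using min M by metis
    also have "\<dots> \<le> ereal S"
      unfolding total_variation_def
    proof (rule SUP_least)
      fix \<zeta> assume "\<zeta> \<in> {\<phi> \<in> C1_compact_fields \<Omega>. \<forall>x. norm (\<phi> x) \<le> 1}"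
      then have \<zeta>: "\<zeta> \<in> C1_compact_fields \<Omega>" "\<And>x. norm (\<zeta> x) \<le> 1" by auto
      have "AE x in lborel. indicat_real \<Omega> x * (u x + W x) = U x + W x"
        using U(2) by eventually_elim (simp add: distrib_left W\<Omega>)
      then have "(\<integral>x. (u x + W x) * divergence \<zeta> x \<partial>lebesgue_on \<Omega>) = (\<integral>x. (U x + W x) * divergence \<zeta> x \<partial>lborel)"
        using iu iW U(1) Wm
        by (intro borel_representative(2)[OF \<Omega>b] borel_measurable_divergence[OF \<zeta>(1)]) auto
      then show "ereal (\<integral>x. (u x + W x) * divergence \<zeta> x \<partial>lebesgue_on \<Omega>) \<le> ereal S"
        using S[OF \<zeta>] by simp
    qed
    finally show "M \<le> S" by simp
  qed
  then show ?thesis by blast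
qed

theorem theorem4p3:
  fixes \<Omega> :: "(real ^ 'n) set" and u :: "real ^ 'n \<Rightarrow> real"
  assumes "open \<Omega>" and "bounded \<Omega>" and "lipschitz_boundary \<Omega>"
    and "u \<in> BV \<Omega>" and "least_gradient \<Omega> u"
  shows "u \<in> Linf_loc \<Omega>"
proof -
  have iu: "integrable (lebesgue_on \<Omega>) u" using assms(4) by (simp add: BV_def)
  have \<Omega>b: "\<Omega> \<in> sets borel" using assms(1) by simp
  obtain U where U: "U \<in> borel_measurable borel" "AE x in lborel. indicat_real \<Omega> x * u x = U x"
    using exists_borel_representative[OF \<Omega>b iu] by blast
  obtain M where "minimizer \<Omega> U M" using least_gradient_minimizer[OF assms(1,5) U] by blast
  then interpret minimizer \<Omega> U M .
  have "\<exists>C. AE x in lebesgue_on K. \<bar>u x\<bar> \<le> C" if K: "compact K" "K \<subseteq> \<Omega>" for K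
  proof -
    obtain C where C: "AE x in lborel. x \<in> K \<longrightarrow> \<bar>U x\<bar> \<le> C" using bounded_on_compact[OF K] by blast
    \<comment> \<open>On \<open>K\<close>, a subset of \<Omega>, the indicator is 1 and
      \<open>U\<close> agrees with \<open>u\<close> almost everywhere.\<close>
    have "AE x in lborel. x \<in> K \<longrightarrow> \<bar>u x\<bar> \<le> C"
      using C U(2)
    proof eventually_elim
      case (elim x)
      then show ?case using K(2) by (auto simp: indicator_def)
    qed
    then have "AE x in lebesgue. x \<in> K \<longrightarrow> \<bar>u x\<bar> \<le> C" by (rule AE_completion)
    moreover have "K \<inter> space lebesgue \<in> sets lebesgue" using borel_compact[OF K(1)] by simp
    ultimately have "AE x in lebesgue_on K. \<bar>u x\<bar> \<le> C" by (simp add: AE_restrict_space_iff)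
    then show ?thesis by blast
  qed
  then show ?thesis using iu by (auto simp: Linf_loc_def)
qed

end
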